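(* Every $2$-connected graph $G$ satisfies $\mathrm{nrc}(G)\leq 15$, and every $4$-connected graph $G$ satisfies $\mathrm{nrc}(G)\leq 6$.
   Context: Graphs are finite, simple and connected. A graph is $k$-connected if it cannot be disconnected by deleting $k-1$ vertices. A repetition is a sequence of the form $c_1c_2\cdots c_nc_1c_2\cdots c_n$ with $n\ge 1$. A block of a sequence is a subsequence of consecutive terms. A path in a graph with colored edges (the coloring is arbitrary) is nonrepetitive if its sequence of edge colors does not contain a repetition as a block. An edge-colored graph is nonrepetitively connected if every pair of distinct vertices is joined by at least one nonrepetitive path. $\mathrm{nrc}(G)$ denotes the least number of colors in an edge coloring of $G$ that makes $G$ nonrepetitively connected. *)

theory Defs
  imports Main "HOL-Library.Sublist"
begin

text \<open>
  A graph is given by its vertex set and its set of edges, an edge being a two-element set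
  of vertices.
\<close>

definition simple_graph :: "'a set \<Rightarrow> 'a set set \<Rightarrow> bool" where
  "simple_graph V E \<longleftrightarrow> finite V \<and> (\<forall>e\<in>E. e \<subseteq> V \<and> card e = 2)"

definition is_path :: "'a set \<Rightarrow> 'a set set \<Rightarrow> 'a \<Rightarrow> 'a list \<Rightarrow> 'a \<Rightarrow> bool" where
  "is_path V E u p v \<longleftrightarrow>
     p \<noteq> [] \<and> hd p = u \<and> last p = v \<and> set p \<subseteq> V \<and> distinct p \<and>
     successively (\<lambda>x y. {x, y} \<in> E) p"

definition connected_graph :: "'a set \<Rightarrow> 'a set set \<Rightarrow> bool" where
  "connected_graph V E \<longleftrightarrow> (\<forall>u\<in>V. \<forall>v\<in>V. \<exists>p. is_path V E u p v)"

text \<open>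
  No lower bound on the number of vertices is imposed, and the graph without vertices counts
  as connected. Hence a complete graph, which no deletion disconnects, is \<open>k\<close>-connected for
  every \<open>k\<close>.
\<close>

definition k_connected :: "nat \<Rightarrow> 'a set \<Rightarrow> 'a set set \<Rightarrow> bool" where
  "k_connected k V E \<longleftrightarrow>
     (\<forall>S\<subseteq>V. card S < k \<longrightarrow> connected_graph (V - S) {e\<in>E. e \<inter> S = {}})"

definition repetition :: "'c list \<Rightarrow> bool" where
  "repetition s \<longleftrightarrow> (\<exists>t. t \<noteq> [] \<and> s = t @ t)"

text \<open>The library predicate \<^const>\<open>sublist\<close> only allows consecutive terms.\<close>

definition nonrepetitive :: "'c list \<Rightarrow> bool" where
  "nonrepetitive s \<longleftrightarrow> \<not> (\<exists>r. repetition r \<and> sublist r s)"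

definition path_colors :: "('a set \<Rightarrow> 'c) \<Rightarrow> 'a list \<Rightarrow> 'c list" where
  "path_colors c p = map2 (\<lambda>x y. c {x, y}) p (tl p)"

definition nonrepetitively_connected ::
    "'a set \<Rightarrow> 'a set set \<Rightarrow> ('a set \<Rightarrow> 'c) \<Rightarrow> bool" where
  "nonrepetitively_connected V E c \<longleftrightarrow>
     (\<forall>u\<in>V. \<forall>v\<in>V. u \<noteq> v \<longrightarrow> (\<exists>p. is_path V E u p v \<and> nonrepetitive (path_colors c p)))"

definition nrc :: "'a set \<Rightarrow> 'a set set \<Rightarrow> nat" where
  "nrc V E =
     (LEAST k. \<exists>c :: 'a set \<Rightarrow> nat. card (c ` E) = k \<and> nonrepetitively_connected V E c)"

text \<open>
  On a connected graph the minimum in the definition of \<^const>\<open>nrc\<close> is attained: giving all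
  edges different colors makes every path nonrepetitive.
\<close>

lemma distinct_nonrepetitive:
  assumes "distinct s"
  shows "nonrepetitive s"
  using assms unfolding nonrepetitive_def repetition_def sublist_def by fastforce

lemma distinct_path_colors:
  assumes "inj_on c E" "distinct p" "successively (\<lambda>x y. {x, y} \<in> E) p"
  shows "distinct (path_colors c p)"
  using assms(2,3)
proof (induction p rule: induct_list012)
  case (3 x y zs)
  have colors: "path_colors c (x # y # zs) = c {x, y} # path_colors c (y # zs)"
    by (simp add: path_colors_def)
  have sub: "\<exists>e\<in>E. d = c e \<and> e \<subseteq> set q"
    if "d \<in> set (path_colors c q)" "successively (\<lambda>x y. {x, y} \<in> E) q" for d q
    using that
  proof (induction q rule: induct_list012)
    case (3 a b q)
    have q: "path_colors c (a # b # q) = c {a, b} # path_colors c (b # q)"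
      by (simp add: path_colors_def)
    show ?case
    proof (cases "d = c {a, b}")
      case True
      then show ?thesis using 3 by auto
    next
      case False
      then have "\<exists>e\<in>E. d = c e \<and> e \<subseteq> set (b # q)" using 3 q by auto
      then show ?thesis by auto
    qed
  qed (auto simp: path_colors_def)
  have "c {x, y} \<notin> set (path_colors c (y # zs))"
  proof
    assume "c {x, y} \<in> set (path_colors c (y # zs))"
    then obtain e where e: "e \<in> E" "c {x, y} = c e" "e \<subseteq> set (y # zs)"
      using sub "3.prems" by force
    then have "{x, y} = e"
      using assms(1) "3.prems" by (auto dest: inj_onD)
    then show False using e(3) "3.prems" by auto
  qed
  then show ?case using 3 colors by simp
qed (auto simp: path_colors_def)

lemma nrc_attained:
  fixes V :: "'a set"
  assumes "simple_graph V E" "connected_graph V E"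
  obtains c :: "'a set \<Rightarrow> nat" where "card (c ` E) = nrc V E" "nonrepetitively_connected V E c"
proof -
  have "finite E"
    using assms(1) unfolding simple_graph_def by (meson PowI finite_Pow_iff finite_subset subsetI)
  then obtain c :: "'a set \<Rightarrow> nat" where "inj_on c E"
    using finite_imp_inj_to_nat_seg by blast
  then have "nonrepetitive (path_colors c p)" if "is_path V E u p v" for u p v
    using that by (simp add: is_path_def distinct_path_colors distinct_nonrepetitive)
  then have "nonrepetitively_connected V E c"
    using assms(2) unfolding nonrepetitively_connected_def connected_graph_def by blast
  then have "\<exists>k. \<exists>c :: 'a set \<Rightarrow> nat. card (c ` E) = k \<and> nonrepetitively_connected V E c"
    by blast
  from LeastI_ex[OF this] show ?thesis
    using that unfolding nrc_def by blast
qed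

end

theory Submission imports Defs begin

text \<open>
  Both bounds rest on one device. Suppose that a root \<open>r\<close> can be reached from every vertex along
  the arcs of a digraph, and color each arc of a shortest path to \<open>r\<close> with the letter that a
  square-free word over three letters has at the level which the arc enters. Then a shortest
  path to \<open>r\<close> is nonrepetitive (\<open>nonrepetitive_descending\<close>). To join \<open>u\<close> to \<open>v\<close>, two such
  systems of paths are used: one leads from \<open>u\<close> towards \<open>r\<close>, the other one is followed
  backwards to \<open>v\<close>. A square in the colors could only cross the seam, and this is impossible if
  the colors at the seam do not occur on the respective other side
  (\<open>nonrepetitive_append\<close>).

  A \<open>4\<close>-connected graph with more than four vertices has at least four edges in every edge cut,
  and hence, by the theorem of Nash-Williams and Tutte (\<open>spanning_packing\<close>), two edge-disjoint
  connected spanning subgraphs. They serve as the two systems, with three colors each. The path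
  of \<open>u\<close> may meet the path of \<open>v\<close> before the root; changing over at the first common vertex
  does no harm because the two palettes are disjoint.

  In a \<open>2\<close>-connected graph, choose an edge \<open>{s, t}\<close> and number the vertices such that each vertex
  besides \<open>s\<close> and \<open>t\<close> has a neighbour with a lower number and one with a higher number
  (\<open>st_numbering_exists\<close>). One system descends to \<open>s\<close> and then steps to the root \<open>t\<close>, the other
  one ascends to \<open>t\<close>. Paths of the two kinds that start at \<open>u\<close> and at a higher \<open>v\<close> are disjoint
  apart from \<open>t\<close>. An edge may have a letter in each system, so the colors are pairs of optional
  letters. At least one letter is always present, which leaves \<open>4 * 4 - 1 = 15\<close> colors, and the
  edges at the seam have only one letter each (\<open>nrc_two_connected\<close>).
\<close>

section \<open>A square-free word over three letters\<close>

text \<open>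
  The Thue--Morse sequence: the parity of the binary digit sum of \<open>n\<close>.
\<close>

fun thue_morse :: "nat \<Rightarrow> bool" where
  "thue_morse n = (if n = 0 then False else thue_morse (n div 2) \<noteq> odd n)"

declare thue_morse.simps [simp del]

lemma thue_morse_double: "thue_morse (2 * n) = thue_morse n"
  by (cases "n = 0") (auto simp: thue_morse.simps[of "2 * n"])

lemma thue_morse_double_Suc: "thue_morse (Suc (2 * n)) = (\<not> thue_morse n)"
  by (auto simp: thue_morse.simps[of "Suc (2 * n)"])

lemma thue_morse_cube_free:
  "\<not> (thue_morse i = thue_morse (i + 1) \<and> thue_morse (i + 1) = thue_morse (i + 2))"
proof (cases "even i")
  case True
  then obtain n where "i = 2 * n" by blast
  then show ?thesis using thue_morse_double[of n] thue_morse_double_Suc[of n] by simp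
next
  case False
  then obtain n where "i = Suc (2 * n)" using oddE by fastforce
  then show ?thesis
    using thue_morse_double[of "Suc n"] thue_morse_double_Suc[of "Suc n"] by simp
qed

text \<open>
  A window of the form \<open>a x a x a\<close> with period \<open>m\<close> is ruled out by descent. If \<open>m\<close> is even, the
  letters at every second position form such a window with period \<open>m div 2\<close>. If \<open>m\<close> is odd, every
  pair of neighbours, or its copy one period away, starts at an even position and so consists of
  different letters; the window therefore alternates. For \<open>m = 1\<close> its letters are also equal, and for larger
  \<open>m\<close> undoing the doubling turns it into three equal letters in a row, which do not occur.
\<close>

lemma thue_morse_overlap_free:
  assumes "m > 0"
  shows "\<exists>j\<le>m. thue_morse (i + j) \<noteq> thue_morse (i + m + j)"
  using assms
proof (induction m arbitrary: i rule: less_induct)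
  case (less m)
  show ?case
  proof (rule ccontr)
    assume "\<not> ?thesis"
    then have eq: "thue_morse (i + j) = thue_morse (i + m + j)" if "j \<le> m" for j
      using that by blast
    show False
    proof (cases "even m")
      case True
      then obtain k where k: "m = 2 * k" by blast
      have "thue_morse (i div 2 + j) = thue_morse (i div 2 + k + j)" if "j \<le> k" for j
      proof (cases "even i")
        case True
        then have "i + 2 * j = 2 * (i div 2 + j)" "i + m + 2 * j = 2 * (i div 2 + k + j)"
          using k by auto
        then show ?thesis using eq[of "2 * j"] that k thue_morse_double by (metis mult_le_mono2)
      next
        case False
        then have "i + 2 * j = Suc (2 * (i div 2 + j))"
          "i + m + 2 * j = Suc (2 * (i div 2 + k + j))"
          using k by presburger+
        then show ?thesis
          using eq[of "2 * j"] that k thue_morse_double_Suc by (metis mult_le_mono2)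
      qed
      then show False using less.IH[of k "i div 2"] less.prems k by auto
    next
      case False
      have block: "thue_morse n \<noteq> thue_morse (Suc n)" if "even n" for n
        using that thue_morse_double thue_morse_double_Suc by (metis evenE)
      have left: "thue_morse (i + j) \<noteq> thue_morse (Suc (i + j))" if "j < m" for j
      proof (cases "even (i + j)")
        case False
        then have "even (i + m + j)" using \<open>odd m\<close> by presburger
        then show ?thesis using block[of "i + m + j"] eq[of j] eq[of "Suc j"] that by simp
      qed (rule block)
      have alt: "thue_morse (i + j) \<noteq> thue_morse (Suc (i + j))" if "j < 2 * m" for j
      proof (cases "j < m")
        case False
        then show ?thesis
          using left[of "j - m"] eq[of "j - m"] eq[of "Suc (j - m)"] that by (simp add: Suc_diff_le)
      qed (rule left)
      show False
      proof (cases "m = 1")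
        case True
        then show False using eq[of 0] eq[of 1] thue_morse_cube_free[of i] by simp
      next
        case m: False
        then have "m \<ge> 3" using \<open>odd m\<close> less.prems by presburger
        \<comment> \<open>the first full pair \<open>2 * n, 2 * n + 1\<close> that lies inside the window\<close>
        define n where "n = Suc i div 2"
        have n: "2 * n = i \<or> 2 * n = Suc i" unfolding n_def by presburger
        have "thue_morse n = thue_morse (Suc n)" if "i \<le> 2 * n" "2 * n < i + 5" for n
          using that alt[of "Suc (2 * n) - i"] \<open>m \<ge> 3\<close> thue_morse_double_Suc[of n]
            thue_morse_double[of "Suc n"] by simp
        from this[of n] this[of "Suc n"] show False
          using n thue_morse_cube_free[of n] by auto
      qed
    qed
  qed
qed

text \<open>
  The letters \<open>0, 1, 2\<close> stand for the difference of two consecutive Thue--Morse letters being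
  zero, negative or positive.
\<close>

definition thue :: "nat \<Rightarrow> nat" where
  "thue n = (if thue_morse n = thue_morse (Suc n) then 0 else if thue_morse n then 1 else 2)"

lemma thue_less_3: "thue n < 3"
  by (simp add: thue_def)

text \<open>
  The differences over a block add up to the change from its start to its end. A square therefore
  makes the same change twice in a row, which among two values is only possible if the change is
  zero; then the Thue--Morse letters repeat along the square and include one letter more, which is
  an overlap.
\<close>

lemma thue_square_free:
  assumes "m > 0"
  shows "\<exists>j<m. thue (i + j) \<noteq> thue (i + m + j)"
proof (rule ccontr)
  assume "\<not> ?thesis"
  then have eq: "thue (i + j) = thue (i + m + j)" if "j < m" for j
    using that by blast
  define b :: "nat \<Rightarrow> int" where "b n = of_bool (thue_morse n)" for n
  have step: "b (Suc (i + j)) - b (i + j) = b (Suc (i + m + j)) - b (i + m + j)" if "j < m" for j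
    using eq[OF that] by (auto simp: thue_def b_def split: if_splits)
  have tele: "(\<Sum>j<m. b (Suc (k + j)) - b (k + j)) = b (k + m) - b k" for k
    using sum_lessThan_telescope[of "\<lambda>j. b (k + j)" m] by simp
  have "b (i + m) - b i = b (i + m + m) - b (i + m)"
    using tele[of i] tele[of "i + m"] sum.cong[OF refl step, of "{..<m}"] by simp
  then have start: "b i = b (i + m)"
    by (auto simp: b_def of_bool_def split: if_splits)
  have "b (i + j) = b (i + m + j)" if "j \<le> m" for j
    using that
  proof (induction j)
    case (Suc j)
    then show ?case using step[of j] by simp
  qed (simp add: start)
  then have "thue_morse (i + j) = thue_morse (i + m + j)" if "j \<le> m" for j
    using that by (force simp: b_def)
  then show False using thue_morse_overlap_free[OF assms, of i] by blast
qed

section \<open>Nonrepetitive sequences\<close>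

lemma nonrepetitive_iff: "nonrepetitive s \<longleftrightarrow> (\<forall>p t q. s = p @ t @ t @ q \<longrightarrow> t = [])"
  unfolding nonrepetitive_def repetition_def sublist_def by (metis append.assoc)

lemma nonrepetitive_thue: "nonrepetitive (map thue [a..<b])"
  unfolding nonrepetitive_iff
proof (intro allI impI, rule ccontr)
  fix p t q assume *: "map thue [a..<b] = p @ t @ t @ q" and "t \<noteq> []"
  have len: "b - a = length p + 2 * length t + length q"
    using arg_cong[OF *, of length] by simp
  have "thue (a + length p + j) = thue (a + length p + length t + j)" if "j < length t" for j
  proof -
    have "thue (a + length p + j) = (p @ t @ t @ q) ! (length p + j)"
      "thue (a + length p + length t + j) = (p @ t @ t @ q) ! (length p + length t + j)"
      unfolding *[symmetric] using that len by (simp_all add: add.assoc)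
    then show ?thesis using that by (simp add: nth_append)
  qed
  then show False using thue_square_free[of "length t" "a + length p"] \<open>t \<noteq> []\<close> by auto
qed

lemma nonrepetitive_rev [simp]: "nonrepetitive (rev s) \<longleftrightarrow> nonrepetitive s"
proof -
  have "nonrepetitive (rev s)" if "nonrepetitive s" for s :: "'b list"
    unfolding nonrepetitive_iff
  proof (intro allI impI)
    fix p t q assume "rev s = p @ t @ t @ q"
    then have "s = rev q @ rev t @ rev t @ rev p" by (simp add: rev_swap)
    then show "t = []" using that unfolding nonrepetitive_iff by fastforce
  qed
  from this[of s] this[of "rev s"] show ?thesis by auto
qed

lemma nonrepetitive_map: "nonrepetitive (map g s) \<Longrightarrow> nonrepetitive s"
  unfolding nonrepetitive_iff by fastforce

text \<open>
  A square across the seam has at least one of its halves entirely on one side, while the other half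
  contains the letter of the opposite side that touches the seam. So it is enough that the two
  letters at the seam do not occur on the other side.
\<close>

lemma nonrepetitive_append:
  assumes A: "nonrepetitive A" and B: "nonrepetitive B"
    and last: "A \<noteq> [] \<Longrightarrow> last A \<notin> set B"
    and hd: "B \<noteq> [] \<Longrightarrow> hd B \<notin> set A"
  shows "nonrepetitive (A @ B)"
  unfolding nonrepetitive_iff
proof (intro allI impI, rule ccontr)
  fix p t q assume *: "A @ B = p @ t @ t @ q" and "t \<noteq> []"
  have "A @ B = (p @ t) @ (t @ q)" using * by simp
  then obtain z where "A = (p @ t) @ z \<and> z @ B = t @ q \<or> A @ z = p @ t \<and> B = z @ t @ q"
    unfolding append_eq_append_conv2 by blast
  then show False
  proof (elim disjE conjE)
    assume Az: "A = (p @ t) @ z" and "z @ B = t @ q"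
    then obtain y where "z = t @ y \<and> y @ B = q \<or> z @ y = t \<and> B = y @ q"
      unfolding append_eq_append_conv2 by blast
    then show False
    proof (elim disjE conjE)
      assume "z = t @ y"
      then have "A = p @ t @ t @ y" using Az by simp
      then show False using A \<open>t \<noteq> []\<close> unfolding nonrepetitive_iff by blast
    next
      assume y: "z @ y = t" "B = y @ q"
      show False
      proof (cases "y = []")
        case True
        then have "A = p @ t @ t @ []" using Az y by simp
        then show False using A \<open>t \<noteq> []\<close> unfolding nonrepetitive_iff by blast
      next
        case False
        then have "hd B \<in> set t" "B \<noteq> []" using y by auto
        then show False using hd Az by auto
      qed
    qed
  next
    assume Az: "A @ z = p @ t" and Bz: "B = z @ t @ q"
    then obtain y where "A = p @ y \<and> y @ z = t \<or> A @ y = p \<and> z = y @ t"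
      unfolding append_eq_append_conv2 by blast
    then show False
    proof (elim disjE conjE)
      assume "z = y @ t"
      then have "B = y @ t @ t @ q" using Bz by simp
      then show False using B \<open>t \<noteq> []\<close> unfolding nonrepetitive_iff by blast
    next
      assume y: "A = p @ y" "y @ z = t"
      show False
      proof (cases "y = []")
        case True
        then have "B = [] @ t @ t @ q" using Bz y by simp
        then show False using B \<open>t \<noteq> []\<close> unfolding nonrepetitive_iff by blast
      next
        case False
        then have "last A \<in> set t" "A \<noteq> []" using y by auto
        then show False using last Bz by auto
      qed
    qed
  qed
qed

section \<open>Colors along paths\<close>

lemma path_colors_simps [simp]:
  "path_colors c [] = []"
  "path_colors c [x] = []"
  "path_colors c (x # y # p) = c {x, y} # path_colors c (y # p)"
  by (simp_all add: path_colors_def)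

lemma map_path_colors: "map h (path_colors c p) = path_colors (\<lambda>e. h (c e)) p"
  by (induction p rule: induct_list012) simp_all

lemma path_colors_append: "path_colors c (p @ x # q) = path_colors c (p @ [x]) @ path_colors c (x # q)"
  by (induction p rule: induct_list012) simp_all

lemma path_colors_rev: "path_colors c (rev p) = rev (path_colors c p)"
proof (induction p rule: induct_list012)
  case (3 x y p)
  have "path_colors c (rev (x # y # p)) = path_colors c (rev p @ y # [x])" by simp
  also have "\<dots> = path_colors c (rev (y # p)) @ [c {y, x}]"
    by (subst path_colors_append) simp
  finally show ?case unfolding "3.IH"(2) by (simp add: insert_commute)
qed simp_all

lemma path_colors_elem:
  assumes "d \<in> set (path_colors c p)" "successively R p"
  obtains x y where "R x y" "d = c {x, y}"
proof -
  have "\<exists>x y. R x y \<and> d = c {x, y}"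
    using assms
  proof (induction p rule: induct_list012)
    case (3 x y p)
    then consider "R x y" "d = c {x, y}" | "\<exists>x y. R x y \<and> d = c {x, y}" by auto
    then show ?case by cases blast+
  qed simp_all
  then show ?thesis using that by (elim exE conjE)
qed

lemma successively_invariant:
  assumes "successively R p" "p \<noteq> []" "Q (hd p)" "\<And>x y. R x y \<Longrightarrow> Q x \<Longrightarrow> Q y"
  shows "\<forall>x\<in>set p. Q x"
  using assms(1-3)
proof (induction p rule: induct_list012)
  case (3 x y p)
  have "Q y" using "3.prems" assms(4)[of x y] by simp
  moreover have "successively R (y # p)" using "3.prems" by simp
  ultimately have "\<forall>z\<in>set (y # p). Q z" using "3.IH"(2) by (metis list.sel(1) list.discI)
  then show ?case using "3.prems"(3) by (metis list.sel(1) set_ConsD)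
qed simp_all

lemma is_path_prefix:
  assumes "is_path V E u (p @ x # q) v"
  shows "is_path V E u (p @ [x]) x"
proof -
  have "successively (\<lambda>x y. {x, y} \<in> E) ((p @ [x]) @ q)" using assms by (simp add: is_path_def)
  then have "successively (\<lambda>x y. {x, y} \<in> E) (p @ [x])" by (subst (asm) successively_append_iff) simp
  moreover have "hd (p @ [x]) = u" using assms by (cases p) (simp_all add: is_path_def)
  ultimately show ?thesis using assms by (simp add: is_path_def)
qed

lemma is_path_join:
  assumes P: "is_path V E u P x" and Q: "is_path V E v Q x" and PQ: "set P \<inter> set Q = {x}"
  shows "is_path V E u (P @ tl (rev Q)) v"
    and "path_colors c (P @ tl (rev Q)) = path_colors c P @ rev (path_colors c Q)"
proof -
  obtain P' where P': "P = P' @ [x]" using P unfolding is_path_def by (metis append_butlast_last_id)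
  obtain Q' where Q': "Q = Q' @ [x]" using Q unfolding is_path_def by (metis append_butlast_last_id)
  have eq: "P @ tl (rev Q) = P' @ x # rev Q'" using P' Q' by simp
  show "path_colors c (P @ tl (rev Q)) = path_colors c P @ rev (path_colors c Q)"
    unfolding eq using P' Q' by (subst path_colors_append) (simp flip: path_colors_rev)
  have "successively (\<lambda>x y. {x, y} \<in> E) (rev Q)"
    using Q by (simp add: is_path_def insert_commute)
  then have "successively (\<lambda>x y. {x, y} \<in> E) (x # rev Q')" using Q' by simp
  then have succ: "successively (\<lambda>x y. {x, y} \<in> E) (P' @ x # rev Q')"
    using P P' by (auto simp: is_path_def successively_append_iff)
  have "last (x # rev Q') = v"
    using Q Q' by (cases Q') (auto simp: is_path_def)
  moreover have "hd (P' @ x # rev Q') = u"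
    using P P' by (cases P') (auto simp: is_path_def)
  ultimately show "is_path V E u (P @ tl (rev Q)) v"
    unfolding eq using succ P Q P' Q' PQ by (auto simp: is_path_def)
qed

lemma is_path_rev: "is_path V E u p v \<Longrightarrow> is_path V E v (rev p) u"
  by (auto simp: is_path_def hd_rev last_rev insert_commute)

text \<open>
  Colors of any type are allowed here, so that the constructions below can use pairs of letters.
\<close>

lemma nrc_le:
  fixes c :: "'a set \<Rightarrow> 'c"
  assumes "nonrepetitively_connected V E c" "c ` E \<subseteq> C" "finite C" "card C \<le> k"
  shows "nrc V E \<le> k"
proof -
  obtain g :: "'c \<Rightarrow> nat" where "inj_on g C"
    using finite_imp_inj_to_nat_seg[OF \<open>finite C\<close>] by blast
  then have g: "inj_on g (c ` E)" using assms(2) inj_on_subset by blast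
  have transfer: "nonrepetitive (path_colors (\<lambda>e. g (c e)) p)"
    if p: "is_path V E u p v" and nonrep: "nonrepetitive (path_colors c p)" for u p v
  proof -
    have "set (path_colors c p) \<subseteq> c ` E"
      using p by (fastforce simp: is_path_def elim!: path_colors_elem)
    then have "map (the_inv_into (c ` E) g) (map g (path_colors c p)) = path_colors c p"
      using g by (auto intro!: map_idI simp: the_inv_into_f_f)
    then show ?thesis using nonrep by (metis map_path_colors nonrepetitive_map)
  qed
  have "nonrepetitively_connected V E (\<lambda>e. g (c e))"
    using assms(1) transfer unfolding nonrepetitively_connected_def by meson
  then have "nrc V E \<le> card ((\<lambda>e. g (c e)) ` E)"
    unfolding nrc_def by (intro Least_le) blast
  also have "\<dots> \<le> card C"
    using assms(2,3) by (metis card_image card_mono g image_image)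
  finally show ?thesis using assms(4) by simp
qed

lemma nrc_le_card_edges:
  assumes "connected_graph V E" "finite E"
  shows "nrc V E \<le> card E"
proof -
  have "nonrepetitively_connected V E (\<lambda>e. e)"
    using assms(1) unfolding nonrepetitively_connected_def connected_graph_def
    by (metis distinct_nonrepetitive distinct_path_colors inj_on_id2 is_path_def)
  then show ?thesis using assms(2) by (intro nrc_le[of V E "\<lambda>e. e" E]) auto
qed

section \<open>Shortest paths to a root and the colors of their levels\<close>

definition level :: "('a \<times> 'a) set \<Rightarrow> 'a \<Rightarrow> 'a \<Rightarrow> nat" where
  "level D r v = (LEAST n. (v, r) \<in> D ^^ n)"

text \<open>
  The arcs that start a shortest path to the root.
\<close>

definition descent :: "('a \<times> 'a) set \<Rightarrow> 'a \<Rightarrow> ('a \<times> 'a) set" where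
  "descent D r = {(x, y) \<in> D. level D r x = Suc (level D r y)}"

lemma descending_path:
  assumes "(v, r) \<in> D\<^sup>*"
  obtains p where "p \<noteq> []" "hd p = v" "last p = r" "distinct p"
    "successively (\<lambda>x y. (x, y) \<in> descent D r) p"
proof -
  have "\<exists>p. p \<noteq> [] \<and> hd p = v \<and> last p = r \<and> successively (\<lambda>x y. (x, y) \<in> descent D r) p"
    using assms
  proof (induction "level D r v" arbitrary: v)
    case (0 v)
    have "(v, r) \<in> D ^^ level D r v"
      unfolding level_def using rtrancl_imp_relpow[OF "0.prems"] by (metis LeastI)
    then have "v = r" using 0 by simp
    then show ?case by (intro exI[of _ "[r]"]) simp
  next
    case (Suc n v)
    have "(v, r) \<in> D ^^ level D r v"
      unfolding level_def using rtrancl_imp_relpow[OF Suc.prems] by (metis LeastI)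
    then obtain x where x: "(v, x) \<in> D" "(x, r) \<in> D ^^ n"
      using Suc.hyps(2) by (metis relpow_Suc_D2)
    have "level D r x \<le> n" unfolding level_def using x(2) by (rule Least_le)
    moreover have "(x, r) \<in> D ^^ level D r x"
      unfolding level_def using x(2) by (rule LeastI)
    then have "(v, r) \<in> D ^^ Suc (level D r x)"
      using x(1) by (rule relpow_Suc_I2[rotated])
    then have "level D r v \<le> Suc (level D r x)"
      unfolding level_def[of D r v] by (rule Least_le)
    ultimately have n: "n = level D r x" using Suc.hyps(2) by simp
    obtain p where p: "p \<noteq> []" "hd p = x" "last p = r"
      "successively (\<lambda>x y. (x, y) \<in> descent D r) p"
      using Suc.hyps(1)[OF n] relpow_imp_rtrancl[OF x(2)] by blast
    have "(v, x) \<in> descent D r" using x(1) n Suc.hyps(2) by (simp add: descent_def)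
    then have "successively (\<lambda>x y. (x, y) \<in> descent D r) (v # p)"
      using p by (simp add: successively_Cons)
    then show ?case using p by (intro exI[of _ "v # p"]) simp
  qed
  then obtain p where p: "p \<noteq> []" "hd p = v" "last p = r"
    and succ: "successively (\<lambda>x y. (x, y) \<in> descent D r) p" by blast
  have "successively (\<lambda>x y. level D r x > level D r y) p"
    using succ by (rule successively_mono) (simp add: descent_def)
  then have "sorted_wrt (\<lambda>x y. level D r x > level D r y) p"
    by (subst (asm) successively_conv_sorted_wrt) (auto simp: transp_def)
  then have "distinct p"
    by (induction p) auto
  then show ?thesis using that[of p] p succ by simp
qed

text \<open>
  Each step enters the next lower level, so the colors spell a block of \<^const>\<open>thue\<close> backwards.
  The function \<open>h\<close> extracts the letter from a color that may carry more information.
\<close>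

lemma nonrepetitive_descending:
  assumes "successively (\<lambda>x y. (x, y) \<in> descent D r) p"
    and "\<And>x y. (x, y) \<in> descent D r \<Longrightarrow> h (c {x, y}) = thue (level D r y)"
  shows "nonrepetitive (path_colors c p)"
proof (cases "p = []")
  case False
  have "level D r (last p) \<le> level D r (hd p) \<and>
    path_colors (\<lambda>e. h (c e)) p = rev (map thue [level D r (last p)..<level D r (hd p)])"
    using assms(1) False
  proof (induction p rule: induct_list012)
    case (3 x y p)
    let ?z = "last (y # p)"
    have xy: "(x, y) \<in> descent D r" using "3.prems" by simp
    then have lev: "level D r x = Suc (level D r y)" by (simp add: descent_def)
    have IH: "level D r ?z \<le> level D r y"
      "path_colors (\<lambda>e. h (c e)) (y # p) = rev (map thue [level D r ?z..<level D r y])"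
      using 3 by simp_all
    have "path_colors (\<lambda>e. h (c e)) (x # y # p)
        = thue (level D r y) # rev (map thue [level D r ?z..<level D r y])"
      using IH(2) assms(2)[OF xy] by simp
    also have "\<dots> = rev (map thue [level D r ?z..<level D r x])"
      using IH(1) by (simp add: lev)
    finally show ?case using IH(1) by (simp add: lev del: path_colors_simps)
  qed simp_all
  then have "nonrepetitive (map h (path_colors c p))"
    by (simp add: map_path_colors nonrepetitive_thue)
  then show ?thesis by (rule nonrepetitive_map)
qed (simp add: nonrepetitive_iff)

section \<open>Connectivity and numberings with lower and higher neighbours\<close>

lemma path_colors_last:
  assumes "successively R p" "path_colors c p \<noteq> []"
  obtains x where "R x (last p)" "last (path_colors c p) = c {x, last p}"
proof -
  have "\<exists>x. R x (last p) \<and> last (path_colors c p) = c {x, last p}"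
    using assms
  proof (induction p rule: induct_list012)
    case (3 x y p)
    show ?case
    proof (cases p)
      case Nil
      then show ?thesis using "3.prems"(1) by auto
    next
      case (Cons z q)
      then have "path_colors c (y # p) \<noteq> []" "successively R (y # p)" using "3.prems"(1) by simp_all
      with "3.IH"(2) show ?thesis by simp
    qed
  qed simp_all
  then show ?thesis using that by (elim exE conjE)
qed

lemma crossing_edge:
  assumes "connected_graph V E" "x \<in> V" "x \<in> X" "y \<in> V" "y \<notin> X"
  obtains a b where "a \<in> X" "b \<notin> X" "{a, b} \<in> E"
proof -
  obtain p where p: "is_path V E x p y" using assms unfolding connected_graph_def by blast
  have "\<exists>a b. a \<in> X \<and> b \<notin> X \<and> {a, b} \<in> E"
  proof (rule ccontr)
    assume no: "\<not> ?thesis"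
    have "\<forall>z\<in>set p. z \<in> X"
      by (rule successively_invariant[of "\<lambda>a b. {a, b} \<in> E"])
        (use p no assms(3) in \<open>auto simp: is_path_def\<close>)
    then show False using p assms(5) by (metis is_path_def last_in_set)
  qed
  then show ?thesis using that by (elim exE conjE)
qed

lemma k_connectedD:
  assumes "k_connected k V E" "S \<subseteq> V" "card S < k"
  shows "connected_graph (V - S) {e \<in> E. e \<inter> S = {}}"
  using assms unfolding k_connected_def by blast

text \<open>
  The condition on inner vertices lets every vertex reach \<open>s\<close> by descending and \<open>t\<close> by ascending
  inside \<open>S\<close>. The set \<open>S\<close> is the part of the graph that has been numbered so far.
\<close>

definition st_numbering :: "'a set set \<Rightarrow> 'a set \<Rightarrow> 'a \<Rightarrow> 'a \<Rightarrow> ('a \<Rightarrow> nat) \<Rightarrow> bool" where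
  "st_numbering E S s t f \<longleftrightarrow>
     inj_on f S \<and> s \<in> S \<and> t \<in> S \<and> f s < f t \<and> (\<forall>v\<in>S. f s \<le> f v \<and> f v \<le> f t) \<and>
     (\<forall>v\<in>S - {s, t}. (\<exists>x\<in>S. {v, x} \<in> E \<and> f x < f v) \<and> (\<exists>x\<in>S. {v, x} \<in> E \<and> f v < f x))"

text \<open>
  The inner vertices of an ear from \<open>a\<close> to \<open>b\<close> are placed in their order right after \<open>a\<close>: the
  neighbours along the ear are then the required lower and higher neighbours. Multiplying the old
  numbers by a number larger than the length of the ear makes room for them.
\<close>

lemma st_numbering_insert_ear:
  assumes num: "st_numbering E S s t f"
    and ab: "a \<in> S" "b \<in> S" "f a < f b"
    and zs: "zs \<noteq> []" "distinct zs" "set zs \<inter> S = {}"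
    and ear: "{a, hd zs} \<in> E" "{last zs, b} \<in> E" "successively (\<lambda>x y. {x, y} \<in> E) zs"
  shows "\<exists>g. st_numbering E (S \<union> set zs) s t g"
proof -
  define N where "N = Suc (length zs)"
  define g where "g v = (if v \<in> S then f v * N
    else f a * N + 1 + the_inv_into {..<length zs} ((!) zs) v)" for v
  have "N > 0" by (simp add: N_def)
  have gS: "g v = f v * N" if "v \<in> S" for v using that by (simp add: g_def)
  have gz: "g (zs ! i) = f a * N + 1 + i" if "i < length zs" for i
  proof -
    have "zs ! i \<notin> S" using that zs(3) nth_mem by blast
    moreover have "the_inv_into {..<length zs} ((!) zs) (zs ! i) = i"
      using that zs(2) by (intro the_inv_into_f_f) (auto simp: inj_on_nth)
    ultimately show ?thesis by (simp add: g_def)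
  qed
  have less: "g v < g w \<longleftrightarrow> f v < f w" if "v \<in> S" "w \<in> S" for v w
    using that \<open>N > 0\<close> by (simp add: gS)
  have "Suc (f a) * N \<le> f b * N" using ab(3) by (intro mult_le_mono1) simp
  then have gb: "g a < g z" "g z < g b" if "z \<in> set zs" for z
    using that ab gz by (auto simp: in_set_conv_nth gS N_def)
  have "g v \<noteq> g z" if "v \<in> S" "z \<in> set zs" for v z
  proof
    assume eq: "g v = g z"
    obtain i where i: "i < length zs" "g z = f a * N + 1 + i"
      using \<open>z \<in> set zs\<close> gz by (metis in_set_conv_nth)
    have "f a * N < f v * N" "f v * N < Suc (f a) * N"
      using eq i gS[OF \<open>v \<in> S\<close>] by (simp_all add: N_def)
    then have "f a < f v" "f v < Suc (f a)" by (simp_all only: mult_less_cancel2)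
    then show False by simp
  qed
  moreover have "inj_on g S"
    using num \<open>N > 0\<close> by (auto simp: inj_on_def gS st_numbering_def)
  moreover have "inj_on g (set zs)"
    using gz by (fastforce simp: inj_on_def in_set_conv_nth)
  ultimately have "inj_on g (S \<union> set zs)"
    unfolding inj_on_Un by blast
  moreover have "g s \<le> g v \<and> g v \<le> g t" if "v \<in> S \<union> set zs" for v
  proof -
    have S: "g s \<le> g x \<and> g x \<le> g t" if "x \<in> S" for x
      using that num gS by (simp add: st_numbering_def)
    show ?thesis
      using that S[of v] S[of a] S[of b] gb[of v] ab by force
  qed
  moreover have "(\<exists>x\<in>S \<union> set zs. {v, x} \<in> E \<and> g x < g v) \<and> (\<exists>x\<in>S \<union> set zs. {v, x} \<in> E \<and> g v < g x)"
    if v: "v \<in> S \<union> set zs - {s, t}" for v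
  proof (cases "v \<in> S")
    case True
    then show ?thesis using num v less unfolding st_numbering_def by blast
  next
    case False
    then obtain i where i: "i < length zs" "v = zs ! i"
      using v by (auto simp: in_set_conv_nth)
    have "v \<in> set zs" using i by simp
    have step: "{zs ! j, zs ! Suc j} \<in> E" if "Suc j < length zs" for j
      using successively_nth[OF ear(3) that] .
    have "\<exists>x\<in>S \<union> set zs. {v, x} \<in> E \<and> g x < g v"
    proof (cases i)
      case 0
      then have "v = hd zs" using i zs(1) by (simp add: hd_conv_nth)
      then show ?thesis
        using ear(1) ab gb[OF \<open>v \<in> set zs\<close>] by (intro bexI[of _ a]) (auto simp: insert_commute)
    next
      case (Suc j)
      then show ?thesis
        using i step[of j] gz by (intro bexI[of _ "zs ! j"]) (auto simp: insert_commute)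
    qed
    moreover have "\<exists>x\<in>S \<union> set zs. {v, x} \<in> E \<and> g v < g x"
    proof (cases "Suc i < length zs")
      case True
      then show ?thesis using i step[of i] gz by (intro bexI[of _ "zs ! Suc i"]) auto
    next
      case False
      then have "i = length zs - 1" using i by simp
      then have "v = last zs" using i zs(1) by (simp add: last_conv_nth)
      then show ?thesis
        using ear(2) ab gb[OF \<open>v \<in> set zs\<close>] by (intro bexI[of _ b]) auto
    qed
    ultimately show ?thesis ..
  qed
  ultimately have "st_numbering E (S \<union> set zs) s t g"
    using num less unfolding st_numbering_def by blast
  then show ?thesis by blast
qed

text \<open>
  By connectedness some new vertex \<open>x\<close> is adjacent to a numbered vertex \<open>a\<close>. Deleting \<open>a\<close> leaves
  a path from \<open>x\<close> to the other numbered vertices; cut at its first numbered vertex \<open>b\<close>, it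
  gives an ear with different ends.
\<close>

lemma st_numbering_extend:
  assumes graph: "simple_graph V E" and conn: "k_connected 2 V E"
    and num: "st_numbering E S s t f" and S: "S \<subset> V"
  shows "\<exists>S' g. S \<subset> S' \<and> S' \<subseteq> V \<and> st_numbering E S' s t g"
proof -
  have st: "s \<in> S" "t \<in> S" "s \<noteq> t" and inj: "inj_on f S"
    using num by (auto simp: st_numbering_def)
  have "connected_graph V E"
    using k_connectedD[OF conn, of "{}"] by simp
  then obtain a x where ax: "a \<in> S" "x \<notin> S" "{a, x} \<in> E"
    using crossing_edge[of V E s S] st S by blast
  then have x: "x \<in> V - {a}" using graph unfolding simple_graph_def by force
  \<comment> \<open>a numbered target other than \<open>a\<close>: one of \<open>s\<close> and \<open>t\<close> will do\<close>
  obtain b' where b': "b' \<in> S" "b' \<noteq> a" using st by blast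
  have "connected_graph (V - {a}) {e \<in> E. e \<inter> {a} = {}}"
    using k_connectedD[OF conn, of "{a}"] ax(1) S by force
  then obtain p where p: "is_path (V - {a}) {e \<in> E. e \<inter> {a} = {}} x p b'"
    using x b' S unfolding connected_graph_def by blast
  then have "p \<noteq> []" "last p = b'" by (simp_all add: is_path_def)
  then have "\<exists>y\<in>set p. y \<in> S" using b'(1) last_in_set by blast
  then obtain zs b q where split: "p = zs @ b # q" "b \<in> S" "\<forall>y\<in>set zs. y \<notin> S"
    using split_list_first_prop[of p "\<lambda>y. y \<in> S"] by blast
  have sub: "set p \<subseteq> V - {a}" and dist: "distinct p" and "hd p = x"
    and succ': "successively (\<lambda>x y. {x, y} \<in> {e \<in> E. e \<inter> {a} = {}}) p"
    using p by (simp_all add: is_path_def)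
  have succ: "successively (\<lambda>x y. {x, y} \<in> E) p"
    using succ' by (rule successively_mono) blast
  have zs: "zs \<noteq> []" "hd zs = x"
    using \<open>hd p = x\<close> split(1,2) ax(2) by (cases zs; auto)+
  have ear: "successively (\<lambda>x y. {x, y} \<in> E) zs" "{last zs, b} \<in> E"
    using succ split(1) zs(1) by (auto simp: successively_append_iff)
  have "f a \<noteq> f b" using inj ax(1) split sub by (auto dest: inj_onD)
  then consider "f a < f b" | "f b < f a" by linarith
  then have "\<exists>g. st_numbering E (S \<union> set zs) s t g"
  proof cases
    case 1
    then show ?thesis
      using st_numbering_insert_ear[OF num ax(1) split(2)] zs dist split ear ax(3) by auto
  next
    case 2
    moreover have "{b, hd (rev zs)} \<in> E" "{last (rev zs), a} \<in> E"
      "successively (\<lambda>x y. {x, y} \<in> E) (rev zs)"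
      using zs ear ax(3) by (simp_all add: hd_rev last_rev insert_commute)
    ultimately show ?thesis
      using st_numbering_insert_ear[OF num split(2) ax(1), of "rev zs"] zs dist split by auto
  qed
  moreover have "S \<subset> S \<union> set zs" "S \<union> set zs \<subseteq> V"
    using zs ax(2) S sub split(1) by (auto dest: hd_in_set)
  ultimately show ?thesis by blast
qed

lemma st_numbering_exists:
  assumes "simple_graph V E" "k_connected 2 V E" "{s, t} \<in> E"
  shows "\<exists>f. st_numbering E V s t f"
proof -
  have fin: "finite V" and st: "s \<in> V" "t \<in> V" "s \<noteq> t"
    using assms(1,3) unfolding simple_graph_def by fastforce+
  have "\<exists>f. st_numbering E V s t f" if "st_numbering E S s t f" "S \<subseteq> V" for S f
    using that
  proof (induction "card (V - S)" arbitrary: S f rule: less_induct)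
    case less
    show ?case
    proof (cases "S = V")
      case False
      then obtain S' g where S': "S \<subset> S'" "S' \<subseteq> V" "st_numbering E S' s t g"
        using st_numbering_extend[OF assms(1,2) less.prems(1)] less.prems(2) by blast
      then have "card (V - S') < card (V - S)"
        using fin by (intro psubset_card_mono) auto
      then show ?thesis using less.hyps S' by blast
    qed (use less in auto)
  qed
  moreover have "st_numbering E {s, t} s t (\<lambda>v. if v = s then 0 else 1)"
    using st by (auto simp: st_numbering_def)
  ultimately show ?thesis using st by (metis empty_subsetI insert_subset)
qed

section \<open>Fifteen colors for 2-connected graphs\<close>

text \<open>
  \<^const>\<open>None\<close> marks the edges that no descending path uses. For an edge of a descending path the
  minimum is the level that the path enters, which makes the letter independent of the direction.
\<close>

definition arc_color :: "('a \<times> 'a) set \<Rightarrow> 'a \<Rightarrow> 'a set \<Rightarrow> nat option" where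
  "arc_color D r e = (if \<exists>(x, y)\<in>descent D r. e = {x, y}
     then Some (thue (Min (level D r ` e))) else None)"

lemma arc_color_descent:
  assumes "(x, y) \<in> descent D r"
  shows "arc_color D r {x, y} = Some (thue (level D r y))"
proof -
  have "Min (level D r ` {x, y}) = level D r y" using assms by (simp add: descent_def)
  then show ?thesis using assms unfolding arc_color_def by auto
qed

lemma arc_color_range: "arc_color D r e \<in> {None, Some 0, Some 1, Some 2}"
  using thue_less_3[of "Min (level D r ` e)"] by (auto simp: arc_color_def)

text \<open>
  Two systems of paths to \<open>t\<close> are colored by levels. In the first one a path descends in the
  numbering to \<open>s\<close> and then takes the edge \<open>{s, t}\<close>; in the second one it ascends to \<open>t\<close>. For
  \<open>u\<close> below \<open>v\<close>, the first path of \<open>u\<close> and the second path of \<open>v\<close> meet only in \<open>t\<close>, since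
  one does not rise above \<open>u\<close> before its last step and the other does not fall below \<open>v\<close>.

  An edge can belong to both systems, so a color is a pair of optional letters, and not both
  components are missing: \<open>4 * 4 - 1\<close> colors. The seam at \<open>t\<close> causes no square: the edge
  \<open>{s, t}\<close> lies in the first system only, whereas the last edge of a path of the second system
  lies in the second system only.
\<close>

theorem nrc_two_connected:
  assumes graph: "simple_graph V E" and conn: "k_connected 2 V E" and st: "{s, t} \<in> E"
  shows "nrc V E \<le> 15"
proof -
  obtain f where f: "st_numbering E V s t f"
    using st_numbering_exists[OF graph conn st] by blast
  then have st_less: "f s < f t" and fmin: "\<And>v. v \<in> V \<Longrightarrow> f s \<le> f v" and fmax: "\<And>v. v \<in> V \<Longrightarrow> f v \<le> f t"
    and inj: "inj_on f V" by (simp_all add: st_numbering_def)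
  have "s \<noteq> t" using st_less by blast
  have V: "x \<in> V" "y \<in> V" if "{x, y} \<in> E" for x y
    using that graph by (auto simp: simple_graph_def)
  define D1 where "D1 = {(x, y). {x, y} \<in> E \<and> x \<noteq> t \<and> f y < f x} \<union> {(s, t)}"
  define D2 where "D2 = {(x, y). {x, y} \<in> E \<and> x \<noteq> s \<and> f x < f y}"
  have E1: "{x, y} \<in> E" if "(x, y) \<in> D1" for x y using that st by (auto simp: D1_def)
  have E2: "{x, y} \<in> E" if "(x, y) \<in> D2" for x y using that by (simp add: D2_def)
  have reach1: "(x, t) \<in> D1\<^sup>*" if "x \<in> V" for x
    using that
  proof (induction "f x" arbitrary: x rule: less_induct)
    case less
    show ?case
    proof (cases "x = t \<or> x = s")
      case True
      then show ?thesis by (auto simp: D1_def)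
    next
      case False
      then obtain y where "y \<in> V" "{x, y} \<in> E" "f y < f x"
        using f less.prems by (auto simp: st_numbering_def)
      then show ?thesis
        using less.hyps[of y] False by (intro converse_rtrancl_into_rtrancl[of x y]) (auto simp: D1_def)
    qed
  qed
  have reach2: "(x, t) \<in> D2\<^sup>*" if "x \<in> V" "x \<noteq> s" for x
    using that
  proof (induction "f t - f x" arbitrary: x rule: less_induct)
    case less
    show ?case
    proof (cases "x = t")
      case False
      then obtain y where y: "y \<in> V" "{x, y} \<in> E" "f x < f y"
        using f less.prems by (auto simp: st_numbering_def)
      moreover have "y \<noteq> s" using y fmin[OF less.prems(1)] by auto
      moreover have "f t - f y < f t - f x" using y fmax[OF y(1)] by simp
      ultimately show ?thesis
        using less.hyps[of y] less.prems
        by (intro converse_rtrancl_into_rtrancl[of x y]) (auto simp: D2_def)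
    qed simp
  qed
  define a where "a = arc_color D1 t"
  define b where "b = arc_color D2 t"
  \<comment> \<open>edges on no descending path receive an arbitrary color of the palette\<close>
  define c where "c e = (if a e = None \<and> b e = None then (Some 0, None) else (a e, b e))" for e
  have a1: "a {x, y} = Some (thue (level D1 t y))" if "(x, y) \<in> descent D1 t" for x y
    using arc_color_descent[OF that] by (simp add: a_def)
  have b2: "b {x, y} = Some (thue (level D2 t y))" if "(x, y) \<in> descent D2 t" for x y
    using arc_color_descent[OF that] by (simp add: b_def)
  \<comment> \<open>the first system enters \<open>t\<close> through \<open>{s, t}\<close> only, the second one never does\<close>
  have into_t: "a {x, t} = None" if "(x, t) \<in> D2" for x
  proof -
    have "{p, q} \<noteq> {x, t}" if pq: "(p, q) \<in> D1" for p q
    proof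
      assume eq: "{p, q} = {x, t}"
      have "p \<noteq> t" using pq \<open>s \<noteq> t\<close> by (auto simp: D1_def)
      then have "p = x" "q = t" using eq by (auto simp: doubleton_eq_iff)
      then show False using pq \<open>(x, t) \<in> D2\<close> by (auto simp: D1_def D2_def)
    qed
    then show ?thesis by (fastforce simp: a_def arc_color_def descent_def)
  qed
  have "b {s, t} = None"
  proof -
    have "{p, q} \<noteq> {s, t}" if pq: "(p, q) \<in> D2" for p q
      using pq st_less by (auto simp: D2_def doubleton_eq_iff)
    then show ?thesis by (fastforce simp: b_def arc_color_def descent_def)
  qed
  have only_s: "x = s" if "(x, t) \<in> D1" for x
    using that fmax[of x] V[OF E1[OF that]] by (auto simp: D1_def)
  have forward: "\<exists>p. is_path V E u p v \<and> nonrepetitive (path_colors c p)"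
    if uv: "u \<in> V" "v \<in> V" "f u < f v" for u v
  proof -
    obtain p where p: "p \<noteq> []" "hd p = u" "last p = t" "distinct p"
      "successively (\<lambda>x y. (x, y) \<in> descent D1 t) p"
      using descending_path[OF reach1[OF uv(1)]] by metis
    have "v \<noteq> s" using uv fmin by (metis leD)
    then obtain q where q: "q \<noteq> []" "hd q = v" "last q = t" "distinct q"
      "successively (\<lambda>x y. (x, y) \<in> descent D2 t) q"
      using descending_path[OF reach2[OF uv(2)]] by metis
    have D1: "(x, y) \<in> D1" if "(x, y) \<in> descent D1 t" for x y
      using that by (simp add: descent_def)
    have D2: "(x, y) \<in> D2" if "(x, y) \<in> descent D2 t" for x y
      using that by (simp add: descent_def)
    have step_p: "y \<in> V \<and> (f y \<le> f u \<or> y = t)"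
      if "(x, y) \<in> descent D1 t" "x \<in> V \<and> (f x \<le> f u \<or> x = t)" for x y
      using D1[OF that(1)] that(2) V(2)[OF E1[OF D1[OF that(1)]]] \<open>s \<noteq> t\<close>
      by (auto simp: D1_def)
    have inv_p: "\<forall>x\<in>set p. x \<in> V \<and> (f x \<le> f u \<or> x = t)"
      by (rule successively_invariant[OF p(5,1) _ step_p]) (simp_all add: uv(1) p(2))
    have step_q: "y \<in> V \<and> f v \<le> f y"
      if "(x, y) \<in> descent D2 t" "x \<in> V \<and> f v \<le> f x" for x y
      using D2[OF that(1)] that(2) V(2)[OF E2[OF D2[OF that(1)]]] by (auto simp: D2_def)
    have inv_q: "\<forall>x\<in>set q. x \<in> V \<and> f v \<le> f x"
      by (rule successively_invariant[OF q(5,1) _ step_q]) (simp_all add: uv(2) q(2))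
    have "successively (\<lambda>x y. {x, y} \<in> E) p" "successively (\<lambda>x y. {x, y} \<in> E) q"
      using successively_mono[OF p(5)] successively_mono[OF q(5)] E1[OF D1] E2[OF D2] by simp_all
    then have path_p: "is_path V E u p t" and path_q: "is_path V E v q t"
      using p(1-4) q(1-4) inv_p inv_q by (auto simp: is_path_def)
    have meet: "set p \<inter> set q = {t}"
      using inv_p inv_q uv(3) p(1,3) q(1,3) last_in_set by fastforce
    let ?A = "path_colors c p" and ?B = "rev (path_colors c q)"
    have "nonrepetitive ?A"
      by (rule nonrepetitive_descending[OF p(5), where h = "the \<circ> fst"]) (simp add: c_def a1)
    moreover have "nonrepetitive ?B"
      unfolding nonrepetitive_rev
      by (rule nonrepetitive_descending[OF q(5), where h = "the \<circ> snd"]) (simp add: c_def b2)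
    moreover have A: "fst d \<noteq> None" if "d \<in> set ?A" for d
      using path_colors_elem[OF that p(5)] by (metis a1 c_def fst_conv option.distinct(1))
    moreover have B: "snd d \<noteq> None" if "d \<in> set ?B" for d
    proof -
      have "d \<in> set (path_colors c q)" using that by simp
      then show ?thesis
        using path_colors_elem[OF _ q(5)] by (metis b2 c_def option.distinct(1) snd_conv)
    qed
    moreover have "snd (last ?A) = None" if ne: "?A \<noteq> []"
    proof -
      obtain x where x: "(x, t) \<in> descent D1 t" "last ?A = c {x, t}"
        using path_colors_last[OF p(5) ne] p(3) by metis
      then have "x = s" using only_s by (simp add: descent_def)
      then show ?thesis using x \<open>b {s, t} = None\<close> by (simp add: c_def)
    qed
    moreover have "fst (hd ?B) = None" if "?B \<noteq> []"
    proof -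
      have ne: "path_colors c q \<noteq> []" using that by simp
      obtain x where x: "(x, t) \<in> descent D2 t" "last (path_colors c q) = c {x, t}"
        using path_colors_last[OF q(5) ne] q(3) by metis
      then have "a {x, t} = None" using into_t by (simp add: descent_def)
      moreover have "b {x, t} \<noteq> None" using b2[OF x(1)] by simp
      ultimately show ?thesis using x that by (simp add: c_def hd_rev)
    qed
    ultimately have "nonrepetitive (?A @ ?B)"
      by (intro nonrepetitive_append) blast+
    then show ?thesis
      using is_path_join[OF path_p path_q meet] by metis
  qed
  have connected: "nonrepetitively_connected V E c"
    unfolding nonrepetitively_connected_def
  proof (intro ballI impI)
    fix u v assume uv: "u \<in> V" "v \<in> V" "u \<noteq> v"
    then consider "f u < f v" | "f v < f u" using inj by (meson inj_onD linorder_neqE_nat)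
    then show "\<exists>p. is_path V E u p v \<and> nonrepetitive (path_colors c p)"
    proof cases
      case 2
      then obtain p where "is_path V E v p u" "nonrepetitive (path_colors c p)"
        using forward uv by blast
      then show ?thesis
        using is_path_rev nonrepetitive_rev path_colors_rev by metis
    qed (use forward uv in blast)
  qed
  define K where "K = {None, Some 0, Some 1, Some (2::nat)}"
  have "a e \<in> K" "b e \<in> K" for e
    unfolding a_def b_def K_def by (rule arc_color_range)+
  moreover have "Some 0 \<in> K" "None \<in> K" by (simp_all add: K_def)
  ultimately have "c e \<in> K \<times> K - {(None, None)}" for e
    unfolding c_def by simp
  then have "c ` E \<subseteq> K \<times> K - {(None, None)}" by (rule image_subsetI)
  moreover have "finite (K \<times> K - {(None, None)})" "card (K \<times> K - {(None, None)}) \<le> 15"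
    by (simp_all add: K_def card_Diff_singleton)
  ultimately show ?thesis using connected by (intro nrc_le)
qed

section \<open>Packing independent sets in a matroid\<close>

text \<open>
  The packing argument uses of connectivity only that it is a closure operator with the exchange
  property, that is, the closure operator of a matroid.
\<close>

locale exchange_closure =
  fixes cl :: "'e set \<Rightarrow> 'e set"
  assumes extensive: "A \<subseteq> cl A"
    and mono: "A \<subseteq> B \<Longrightarrow> cl A \<subseteq> cl B"
    and idem: "cl (cl A) = cl A"
    and exchange: "x \<in> cl (insert y A) \<Longrightarrow> x \<notin> cl A \<Longrightarrow> y \<in> cl (insert x A)"
begin

definition indep :: "'e set \<Rightarrow> bool" where
  "indep A \<longleftrightarrow> (\<forall>x\<in>A. x \<notin> cl (A - {x}))"

lemma closure_subset: "A \<subseteq> cl B \<Longrightarrow> cl A \<subseteq> cl B"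
  using mono[of A "cl B"] idem by simp

lemma indep_subset: "indep A \<Longrightarrow> B \<subseteq> A \<Longrightarrow> indep B"
  unfolding indep_def using mono by (meson Diff_mono subset_refl subsetD)

lemma indep_insert:
  assumes "indep A" "e \<notin> cl A"
  shows "indep (insert e A)"
  unfolding indep_def
proof
  fix x assume x: "x \<in> insert e A"
  have "e \<notin> A" using assms(2) extensive by blast
  show "x \<notin> cl (insert e A - {x})"
  proof (cases "x = e")
    case True
    then show ?thesis using assms(2) \<open>e \<notin> A\<close> by simp
  next
    case False
    then have "x \<in> A" "insert e A - {x} = insert e (A - {x})" using x by auto
    then show ?thesis
      using assms exchange[of x e "A - {x}"] by (metis indep_def insert_Diff)
  qed
qed

text \<open>
  The elements of \<open>A\<close> that can be traded for \<open>e\<close> already span \<open>e\<close>, for they include every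
  minimal subset of \<open>A\<close> that spans \<open>e\<close>.
\<close>

lemma fundamental_circuit:
  assumes "indep A" "finite A" "e \<in> cl A"
  shows "e \<in> cl {a \<in> A. e \<notin> cl (A - {a})}"
proof -
  obtain D where D: "D \<subseteq> A" "e \<in> cl D"
    and least: "\<And>D'. D' \<subseteq> A \<Longrightarrow> e \<in> cl D' \<Longrightarrow> card D \<le> card D'"
    using ex_has_least_nat[of "\<lambda>D. D \<subseteq> A \<and> e \<in> cl D" A card] assms(3) by auto
  have "e \<notin> cl (A - {a})" if a: "a \<in> D" for a
  proof
    assume e: "e \<in> cl (A - {a})"
    have "finite D" using D(1) assms(2) finite_subset by blast
    then have "card (D - {a}) < card D" using a by (rule card_Diff1_less)
    then have "e \<notin> cl (D - {a})" using least[of "D - {a}"] D(1) by auto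
    moreover have "e \<in> cl (insert a (D - {a}))" using D(2) a by (simp add: insert_absorb)
    ultimately have "a \<in> cl (insert e (D - {a}))" using exchange by blast
    moreover have "insert e (D - {a}) \<subseteq> cl (A - {a})"
      using e D(1) extensive[of "A - {a}"] by auto
    ultimately have "a \<in> cl (A - {a})" using closure_subset by blast
    then show False using assms(1) a D(1) unfolding indep_def by blast
  qed
  then have "D \<subseteq> {a \<in> A. e \<notin> cl (A - {a})}" using D(1) by blast
  then show ?thesis using mono D(2) by blast
qed

definition packing :: "'e set \<Rightarrow> ('i \<Rightarrow> 'e set) \<Rightarrow> bool" where
  "packing E F \<longleftrightarrow> (\<forall>i. F i \<subseteq> E \<and> indep (F i)) \<and> (\<forall>i j. i \<noteq> j \<longrightarrow> F i \<inter> F j = {})"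

text \<open>
  One step gives an uncovered element \<open>e\<close> to the part \<open>i\<close> in return for an element \<open>d\<close>, which
  becomes uncovered. Sequences of such steps lead from \<open>F\<close> to \<open>G\<close>.
\<close>

inductive exchanges :: "'e set \<Rightarrow> ('i \<Rightarrow> 'e set) \<Rightarrow> ('i \<Rightarrow> 'e set) \<Rightarrow> bool" for E F where
  refl: "exchanges E F F"
| swap: "exchanges E F (G(i := insert e (G i - {d})))"
    if "exchanges E F G" "e \<in> E" "e \<notin> (\<Union>j. G j)" "d \<in> G i" "e \<notin> cl (G i - {d})"

lemma packing_subset: "packing E F \<Longrightarrow> (\<Union>i. F i) \<subseteq> E"
  unfolding packing_def by blast

lemma packing_disjoint: "packing E F \<Longrightarrow> d \<in> F i \<Longrightarrow> j \<noteq> i \<Longrightarrow> d \<notin> F j"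
  unfolding packing_def by blast

lemma packing_insert:
  assumes "packing E G" "B \<subseteq> G i" "e \<in> E" "e \<notin> (\<Union>j. G j)" "e \<notin> cl B"
  shows "packing E (G(i := insert e B))"
proof -
  have "indep (insert e B)"
    using assms(1,2,5) by (auto intro!: indep_insert intro: indep_subset simp: packing_def)
  moreover have "insert e B \<subseteq> E" using assms by (auto simp: packing_def)
  moreover have "insert e B \<inter> G j = {}" if "j \<noteq> i" for j
    using assms that unfolding packing_def by blast
  ultimately show ?thesis using assms(1) unfolding packing_def by (auto simp: fun_upd_def)
qed

lemma exchanges_packing:
  assumes "exchanges E F G" "packing E F" "finite E"
  shows "packing E G \<and> card (\<Union>i. G i) = card (\<Union>i. F i)"
  using assms(1)
proof induction
  case (swap G e d i)
  let ?G = "G(i := insert e (G i - {d}))"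
  have G: "packing E G" using swap by blast
  have "packing E ?G" by (rule packing_insert[OF G]) (use swap in auto)
  have fin: "finite (\<Union>j. G j)"
    using finite_subset[OF packing_subset[OF G] assms(3)] .
  have "d \<notin> G j" if "j \<noteq> i" for j using packing_disjoint[OF G swap(4) that] .
  then have "(\<Union>j. ?G j) = insert e ((\<Union>j. G j) - {d})"
    by (auto split: if_splits) metis
  moreover have "card (insert e ((\<Union>j. G j) - {d})) = card (\<Union>j. G j)"
    using fin swap(3,4) by (subst card_insert_disjoint) (auto intro!: card_Suc_Diff1)
  ultimately have "card (\<Union>j. ?G j) = card (\<Union>j. F j)" using swap.IH by metis
  with \<open>packing E ?G\<close> show ?case ..
qed (simp add: assms(2))

text \<open>
  This is the core of the matroid union theorem. Take a packing \<open>F\<close> that covers as many elements as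
  possible, and let \<open>R\<close> be the set of elements that some sequence of exchanges leaves uncovered.
  Consider a packing \<open>G\<close> reached in this way and an element \<open>e\<close> that it leaves uncovered. Since
  \<open>G\<close> cannot be enlarged, each part \<open>G i\<close> spans \<open>e\<close>. The elements of \<open>G i\<close> that can be
  exchanged for \<open>e\<close> already span it, and they lie in \<open>R\<close>, so \<open>G i \<inter> R\<close> spans \<open>e\<close>.
  For the same reason an exchange does not change the closure of \<open>G i \<inter> R\<close>. Going back to
  \<open>F\<close>, every part \<open>F i \<inter> R\<close> spans all of \<open>R\<close>.
\<close>

theorem packing_saturation:
  assumes "finite E"
  obtains F :: "'i \<Rightarrow> 'e set" and R where
    "packing E F" "R \<subseteq> E" "E - (\<Union>i. F i) \<subseteq> R" "\<And>i. R \<subseteq> cl (F i \<inter> R)"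
proof -
  have "packing E (\<lambda>i :: 'i. {})" by (simp add: packing_def indep_def)
  moreover have bound: "card (\<Union>i. F i) < Suc (card E)" if "packing E F" for F :: "'i \<Rightarrow> 'e set"
    using that assms unfolding packing_def by (meson UN_least card_mono le_imp_less_Suc)
  ultimately obtain F :: "'i \<Rightarrow> 'e set" where F: "packing E F"
    and largest: "\<And>G :: 'i \<Rightarrow> 'e set. packing E G \<Longrightarrow> card (\<Union>i. G i) \<le> card (\<Union>i. F i)"
    using Lattices_Big.ex_has_greatest_nat[of "packing E" "\<lambda>i :: 'i. {}" "\<lambda>G. card (\<Union>i. G i)" "Suc (card E)"]
    by blast
  define R where "R = {e \<in> E. \<exists>G. exchanges E F G \<and> e \<notin> (\<Union>i. G i)}"
  have swap_R: "e \<in> R" "d \<in> R"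
    if "exchanges E F G" "e \<in> E" "e \<notin> (\<Union>j. G j)" "d \<in> G i" "e \<notin> cl (G i - {d})" for G e d i
  proof -
    show "e \<in> R" using that unfolding R_def by blast
    have G: "packing E G" using exchanges_packing[OF that(1) F assms] by blast
    have "d \<notin> (G(i := insert e (G i - {d}))) j" for j
      using that(3,4) packing_disjoint[OF G that(4)] by (cases "j = i") auto
    moreover have "d \<in> E" using G that(4) unfolding packing_def by blast
    ultimately show "d \<in> R" using exchanges.swap[OF that] unfolding R_def by blast
  qed
  have uncovered: "e \<in> cl (G i \<inter> R)"
    if G: "exchanges E F G" and e: "e \<in> E" "e \<notin> (\<Union>j. G j)" for G e i
  proof -
    have pack: "packing E G" and card: "card (\<Union>i. G i) = card (\<Union>i. F i)"
      using exchanges_packing[OF G F assms] by auto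
    have fin: "finite (\<Union>j. G j)"
      using finite_subset[OF packing_subset[OF pack] assms] .
    have "e \<in> cl (G i)"
    proof (rule ccontr)
      assume "e \<notin> cl (G i)"
      then have "packing E (G(i := insert e (G i)))"
        using packing_insert[OF pack _ e] by blast
      moreover have "(\<Union>j. (G(i := insert e (G i))) j) = insert e (\<Union>j. G j)"
        by (auto split: if_splits)
      ultimately have "card (insert e (\<Union>j. G j)) \<le> card (\<Union>i. F i)"
        using largest by metis
      then show False using fin e(2) card by simp
    qed
    moreover have "indep (G i)" "finite (G i)"
      using pack assms finite_subset unfolding packing_def by blast+
    ultimately have "e \<in> cl {d \<in> G i. e \<notin> cl (G i - {d})}"
      by (intro fundamental_circuit)
    moreover have "{d \<in> G i. e \<notin> cl (G i - {d})} \<subseteq> G i \<inter> R"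
      using swap_R(2)[OF G e] by blast
    ultimately show ?thesis using mono by blast
  qed
  have invariant: "cl (G j \<inter> R) = cl (F j \<inter> R)" if "exchanges E F G" for G j
    using that
  proof induction
    case (swap G e d i)
    have eR: "e \<in> R" and dR: "d \<in> R" using swap_R[OF swap.hyps] by auto
    show ?case
    proof (cases "j = i")
      case True
      let ?B = "G i \<inter> R"
      have eB: "e \<in> cl ?B" using uncovered swap.hyps by blast
      have B: "?B = insert d (?B - {d})" using swap.hyps(4) dR by blast
      have "insert e (?B - {d}) \<subseteq> cl ?B" using eB extensive[of ?B] by blast
      then have "cl (insert e (?B - {d})) \<subseteq> cl ?B" by (rule closure_subset)
      moreover have "e \<notin> cl (?B - {d})"
        using swap.hyps(5) mono[of "?B - {d}" "G i - {d}"] by blast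
      then have "d \<in> cl (insert e (?B - {d}))" using exchange[of e d "?B - {d}"] eB B by simp
      then have "?B \<subseteq> cl (insert e (?B - {d}))"
        using extensive[of "insert e (?B - {d})"] by blast
      then have "cl ?B \<subseteq> cl (insert e (?B - {d}))" by (rule closure_subset)
      moreover have "insert e (G i - {d}) \<inter> R = insert e (?B - {d})" using eR by blast
      ultimately show ?thesis using swap.IH True by simp
    qed (use swap.IH in simp)
  qed simp
  have "R \<subseteq> cl (F i \<inter> R)" for i
  proof
    fix e assume "e \<in> R"
    then obtain G where G: "e \<in> E" "exchanges E F G" "e \<notin> (\<Union>i. G i)" unfolding R_def by blast
    show "e \<in> cl (F i \<inter> R)" using uncovered[OF G(2,1,3)] invariant[OF G(2)] by simp
  qed
  moreover have "R \<subseteq> E" "E - (\<Union>i. F i) \<subseteq> R" unfolding R_def using exchanges.refl by blast+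
  ultimately show ?thesis using that F by blast
qed

end

section \<open>Edge-disjoint connected spanning subgraphs\<close>

text \<open>
  A set of arcs stands for an undirected graph in which each edge is oriented in one arbitrary way.
  Connectivity in this graph, as a set of pairs of vertices, is again a set of arcs, and in this
  form it is the closure operator of the graphic matroid.
\<close>

definition connectivity :: "('a \<times> 'a) set \<Rightarrow> ('a \<times> 'a) set" where
  "connectivity A = (A \<union> A\<inverse>)\<^sup>*"

lemma equiv_connectivity: "equiv UNIV (connectivity A)"
proof -
  have "sym (A \<union> A\<inverse>)" by (auto simp: sym_def)
  then show ?thesis unfolding connectivity_def
    by (intro equivI refl_rtrancl sym_rtrancl trans_rtrancl) auto
qed

lemma connectivity_trans:
  "(x, y) \<in> connectivity A \<Longrightarrow> (y, z) \<in> connectivity A \<Longrightarrow> (x, z) \<in> connectivity A"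
  unfolding connectivity_def by (rule rtrancl_trans)

lemma connectivity_sym: "(x, y) \<in> connectivity A \<Longrightarrow> (y, x) \<in> connectivity A"
  using equiv_connectivity[of A] unfolding equiv_def sym_def by blast

lemma connectivity_refl: "(x, x) \<in> connectivity A"
  by (simp add: connectivity_def)

lemma connectivity_insert:
  assumes "(x, y) \<in> connectivity (insert (a, b) A)"
  shows "(x, y) \<in> connectivity A \<or> (x, a) \<in> connectivity A \<and> (b, y) \<in> connectivity A
    \<or> (x, b) \<in> connectivity A \<and> (a, y) \<in> connectivity A"
  using assms unfolding connectivity_def[of "insert (a, b) A"]
proof (induction rule: rtrancl_induct)
  case (step y z)
  then consider "(y, z) \<in> connectivity A" | "y = a" "z = b" | "y = b" "z = a"
    by (auto simp: connectivity_def)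
  then show ?case
  proof cases
    case 1
    then show ?thesis using step.IH connectivity_trans by metis
  next
    case 2
    then show ?thesis using step.IH connectivity_refl connectivity_trans connectivity_sym by metis
  next
    case 3
    then show ?thesis using step.IH connectivity_refl connectivity_trans connectivity_sym by metis
  qed
qed (simp add: connectivity_refl)

interpretation connectivity: exchange_closure connectivity
proof
  fix A B :: "('a \<times> 'a) set" and x y
  show ext: "A \<subseteq> connectivity A" by (auto simp: connectivity_def)
  show mono: "A \<subseteq> B \<Longrightarrow> connectivity A \<subseteq> connectivity B" for A B
    unfolding connectivity_def by (intro rtrancl_mono) blast
  have "connectivity A \<union> (connectivity A)\<inverse> = connectivity A"
    using connectivity_sym by fastforce
  then show "connectivity (connectivity A) = connectivity A"
    unfolding connectivity_def[of "connectivity A"] by (simp add: connectivity_def)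
  show "y \<in> connectivity (insert x A)"
    if "x \<in> connectivity (insert y A)" "x \<notin> connectivity A"
  proof -
    obtain p q a b where xy: "x = (p, q)" "y = (a, b)" by (metis surj_pair)
    have old: "connectivity A \<subseteq> connectivity (insert x A)" by (rule mono) blast
    have "(p, q) \<in> connectivity (insert x A)"
      unfolding xy connectivity_def by blast
    moreover have "(p, a) \<in> connectivity A \<and> (b, q) \<in> connectivity A
      \<or> (p, b) \<in> connectivity A \<and> (a, q) \<in> connectivity A"
      using connectivity_insert that unfolding xy by metis
    ultimately have "(a, b) \<in> connectivity (insert x A)"
      using old connectivity_trans connectivity_sym by (metis subsetD)
    then show ?thesis by (simp add: xy)
  qed
qed

text \<open>
  The quotient \<open>V // connectivity A\<close> is the set of components.
\<close>

lemma card_quotient_insert: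
  assumes "finite V" "x \<in> V" "y \<in> V" "(x, y) \<notin> connectivity A"
  shows "card (V // connectivity (insert (x, y) A)) < card (V // connectivity A)"
proof -
  let ?A = "connectivity A" and ?B = "connectivity (insert (x, y) A)"
  have sub: "?A \<subseteq> ?B" by (rule connectivity.mono) blast
  have cls: "?B `` (?A `` {z}) = ?B `` {z}" for z
    using sub connectivity_trans connectivity_refl by fastforce
  have "(x, y) \<in> ?B" unfolding connectivity_def by blast
  then have xy: "?B `` {x} = ?B `` {y}" by (rule equiv_class_eq[OF equiv_connectivity])
  have ne: "?A `` {x} \<noteq> ?A `` {y}"
    using assms(4) by (metis Image_singleton_iff connectivity_refl)
  have "V // ?B \<subseteq> (``) ?B ` (V // ?A - {?A `` {x}})"
  proof
    fix X assume "X \<in> V // ?B"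
    then obtain z where z: "z \<in> V" "X = ?B `` {z}" by (rule quotientE)
    show "X \<in> (``) ?B ` (V // ?A - {?A `` {x}})"
    proof (cases "?A `` {z} = ?A `` {x}")
      case True
      then have "X = ?B `` (?A `` {y})" using z cls xy by metis
      then show ?thesis using ne assms(3) by (blast intro: quotientI)
    next
      case False
      then show ?thesis using z cls by (blast intro: quotientI)
    qed
  qed
  moreover have fin: "finite (V // ?A)" using assms(1) by (simp add: quotient_def)
  ultimately have "card (V // ?B) \<le> card (V // ?A - {?A `` {x}})"
    by (meson finite_Diff surj_card_le)
  also have "\<dots> < card (V // ?A)"
    using fin quotientI[OF assms(2)] by (intro card_Diff1_less)
  finally show ?thesis .
qed

lemma card_quotient_indep:
  assumes "finite V" "finite C" "A \<inter> C = {}" "C \<subseteq> V \<times> V" "connectivity.indep (A \<union> C)"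
  shows "card (V // connectivity (A \<union> C)) + card C \<le> card (V // connectivity A)"
  using assms(2-5)
proof (induction C rule: finite_induct)
  case (insert c C)
  have "connectivity.indep (A \<union> C)"
    using insert.prems(3) by (rule connectivity.indep_subset) blast
  then have IH: "card (V // connectivity (A \<union> C)) + card C \<le> card (V // connectivity A)"
    using insert by blast
  have "A \<union> insert c C - {c} = A \<union> C" using insert.hyps(2) insert.prems(1) by blast
  then have "c \<notin> connectivity (A \<union> C)"
    using insert.prems(3) unfolding connectivity.indep_def by (metis UnI2 insertI1)
  moreover obtain x y where "c = (x, y)" by (metis surj_pair)
  ultimately have "card (V // connectivity (A \<union> insert c C)) < card (V // connectivity (A \<union> C))"
    using card_quotient_insert[OF assms(1), of x y "A \<union> C"] insert.prems(2) by simp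
  then show ?case using IH insert.hyps by simp
qed simp

text \<open>
  The tree packing theorem of Nash-Williams and Tutte, under the stronger hypothesis on edge cuts
  that at least twice as many edges leave every nonempty proper part as there are subgraphs to be
  found. Take \<open>F\<close>
  and \<open>R\<close> from the saturation theorem and suppose that \<open>R\<close> has \<open>c \<ge> 2\<close> components. Each
  \<open>F i \<inter> R\<close> has the same components, so the forest \<open>F i\<close> contains at most \<open>c - 1\<close> edges
  outside of \<open>R\<close>. All edges between different components are among these. But by the
  hypothesis, counting the edges that leave each component counts every such edge twice and
  gives at least \<open>c\<close> such edges per subgraph.
\<close>

theorem spanning_packing:
  fixes V :: "'a set" and G :: "('a \<times> 'a) set"
  assumes "finite V" "G \<subseteq> V \<times> V"
    and cut: "\<And>X. X \<subset> V \<Longrightarrow> X \<noteq> {} \<Longrightarrow>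
      2 * card (UNIV :: 'i::finite set) \<le> card {(x, y) \<in> G. x \<in> X \<longleftrightarrow> y \<notin> X}"
  obtains F :: "'i::finite \<Rightarrow> ('a \<times> 'a) set" where
    "\<And>i. F i \<subseteq> G" "\<And>i j. i \<noteq> j \<Longrightarrow> F i \<inter> F j = {}" "\<And>i. V \<times> V \<subseteq> connectivity (F i)"
proof -
  have fin: "finite G" using assms(1,2) by (meson finite_SigmaI finite_subset)
  obtain F :: "'i \<Rightarrow> ('a \<times> 'a) set" and R where F: "connectivity.packing G F"
    and R: "R \<subseteq> G" "G - (\<Union>i. F i) \<subseteq> R" "\<And>i. R \<subseteq> connectivity (F i \<inter> R)"
    by (rule connectivity.packing_saturation[OF fin]) blast
  let ?Q = "connectivity R"
  have Q: "connectivity (F i \<inter> R) = ?Q" for i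
    using connectivity.closure_subset[OF R(3)] connectivity.mono[of "F i \<inter> R" R] by blast
  have FG: "F i \<subseteq> G" "connectivity.indep (F i)" for i
    using F unfolding connectivity.packing_def by blast+
  have equiv: "equiv UNIV ?Q" by (rule equiv_connectivity)
  have finQ: "finite (V // ?Q)" using assms(1) by (simp add: quotient_def)
  have "V \<times> V \<subseteq> ?Q"
  proof (rule ccontr)
    assume "\<not> V \<times> V \<subseteq> ?Q"
    then obtain u v where uv: "u \<in> V" "v \<in> V" "(u, v) \<notin> ?Q" by blast
    define c where "c = card (V // ?Q)"
    define cross where "cross = G - ?Q"
    have "finite cross" using fin by (simp add: cross_def)
    have forest: "card (F i - R) + 1 \<le> c" for i
    proof -
      have eq: "F i \<inter> R \<union> (F i - R) = F i" by blast
      have "card (V // connectivity (F i)) + card (F i - R) \<le> c"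
        using card_quotient_indep[of V "F i - R" "F i \<inter> R"] assms(1,2) FG[of i] fin
        unfolding eq Q c_def by (metis Diff_subset Int_Diff_disjoint finite_Diff finite_subset subset_trans)
      moreover have "card (V // connectivity (F i)) \<noteq> 0"
        using uv(1) assms(1) by (auto simp: quotient_def)
      ultimately show ?thesis by simp
    qed
    have "cross \<subseteq> (\<Union>i. F i - R)"
      using R(2) connectivity.extensive[of R] by (auto simp: cross_def)
    then have "card cross \<le> card (\<Union>i. F i - R)"
      using FG(1) fin by (intro card_mono) (auto intro: finite_subset)
    also have "\<dots> \<le> (\<Sum>i\<in>UNIV. card (F i - R))" by (rule card_UN_le) simp
    also have "\<dots> \<le> (\<Sum>i\<in>(UNIV :: 'i set). c - 1)"
      by (intro sum_mono) (use forest in \<open>meson add_le_imp_le_diff\<close>)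
    finally have upper: "card cross \<le> card (UNIV :: 'i set) * (c - 1)" by simp
    have lower: "2 * card (UNIV :: 'i set) \<le> card {p \<in> cross. fst p \<in> X \<longleftrightarrow> snd p \<notin> X}"
      if X: "X \<in> V // ?Q" for X
    proof -
      obtain z where z: "z \<in> V" "X = ?Q `` {z}" using X by (rule quotientE)
      have QV: "y \<in> V" if "(x, y) \<in> ?Q" "x \<in> V" for x y
        using that R(1) assms(2) unfolding connectivity_def
        by (induction rule: rtrancl_induct) auto
      have "X \<subseteq> V" using z QV by blast
      moreover have "X \<noteq> V"
      proof
        assume "X = V"
        then have "(z, u) \<in> ?Q" "(z, v) \<in> ?Q" using z(2) uv(1,2) by auto
        then show False using uv(3) connectivity_trans[OF connectivity_sym] by metis
      qed
      moreover have "X \<noteq> {}" using z(2) connectivity_refl[of z R] by auto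
      ultimately have "2 * card (UNIV :: 'i set) \<le> card {(x, y) \<in> G. x \<in> X \<longleftrightarrow> y \<notin> X}" using cut by blast
      also have "\<dots> \<le> card {p \<in> cross. fst p \<in> X \<longleftrightarrow> snd p \<notin> X}"
      proof (rule card_mono)
        show "{(x, y) \<in> G. x \<in> X \<longleftrightarrow> y \<notin> X} \<subseteq> {p \<in> cross. fst p \<in> X \<longleftrightarrow> snd p \<notin> X}"
        proof (clarify, intro conjI)
          fix x y assume xy: "(x, y) \<in> G" "x \<in> X \<longleftrightarrow> y \<notin> X"
          have "(x, y) \<notin> ?Q"
            using xy(2) connectivity_trans[of z _ R] connectivity_sym[of x y R] unfolding z(2) by auto
          then show "(x, y) \<in> cross" using xy(1) by (simp add: cross_def)
        qed simp
      qed (use \<open>finite cross\<close> in simp)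
      finally show ?thesis .
    qed
    have "c * (2 * card (UNIV :: 'i set)) \<le> (\<Sum>X\<in>V // ?Q. card {p \<in> cross. fst p \<in> X \<longleftrightarrow> snd p \<notin> X})"
      using sum_mono[OF lower, of "V // ?Q"] by (simp add: c_def)
    also have "\<dots> = (\<Sum>p\<in>cross. card {X \<in> V // ?Q. fst p \<in> X \<longleftrightarrow> snd p \<notin> X})"
      by (rule sum_multicount_gen) (simp_all add: finQ \<open>finite cross\<close>)
    also have "\<dots> \<le> (\<Sum>p\<in>cross. 2)"
    proof (rule sum_mono)
      fix p assume "p \<in> cross"
      have "{X \<in> V // ?Q. fst p \<in> X \<longleftrightarrow> snd p \<notin> X} \<subseteq> {?Q `` {fst p}, ?Q `` {snd p}}"
        by (auto elim!: quotientE dest: equiv_class_eq[OF equiv])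
      then have "card {X \<in> V // ?Q. fst p \<in> X \<longleftrightarrow> snd p \<notin> X} \<le> card {?Q `` {fst p}, ?Q `` {snd p}}"
        by (intro card_mono) auto
      also have "\<dots> \<le> 2" by (simp add: card_insert_if)
      finally show "card {X \<in> V // ?Q. fst p \<in> X \<longleftrightarrow> snd p \<notin> X} \<le> 2" .
    qed
    finally have "c * card (UNIV :: 'i set) \<le> card cross" by simp
    then have "card (UNIV :: 'i set) * c \<le> card (UNIV :: 'i set) * (c - 1)"
      using upper mult.commute[of c] by (metis le_trans)
    moreover have "card (UNIV :: 'i set) > 0" by (simp add: card_gt_0_iff)
    ultimately have "c \<le> c - 1" by (simp only: mult_le_cancel1)
    moreover have "c \<ge> 1" using forest[of undefined] by simp
    ultimately show False by simp
  qed
  then have "V \<times> V \<subseteq> connectivity (F i)" for i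
    using Q[of i] connectivity.mono[of "F i \<inter> R" "F i"] by blast
  then show ?thesis
    using that[of F] FG(1) F unfolding connectivity.packing_def by blast
qed

section \<open>Edge cuts of highly connected graphs\<close>

lemma simple_graph_edge:
  assumes "simple_graph V E" "e \<in> E" "x \<in> e"
  shows "\<exists>y. e = {x, y}"
proof -
  obtain p q where pq: "e = {p, q}" using assms(1,2) by (auto simp: simple_graph_def card_2_iff)
  then consider "x = p" | "x = q" using assms(3) by blast
  then show ?thesis using pq by cases blast+
qed

lemma min_degree:
  assumes graph: "simple_graph V E" and conn: "k_connected k V E" and large: "k < card V" and x: "x \<in> V"
  shows "k \<le> card {y. {x, y} \<in> E}"
proof (rule ccontr)
  assume few: "\<not> ?thesis"
  let ?N = "{y. {x, y} \<in> E}"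
  have N: "?N \<subseteq> V" and fin: "finite V" using graph by (auto simp: simple_graph_def)
  have loop: "x \<notin> ?N" using graph by (auto simp: simple_graph_def)
  have "card (insert x ?N) < card V" using few large finite_subset[OF N fin] loop by simp
  then obtain y where y: "y \<in> V" "y \<noteq> x" "y \<notin> ?N"
    using fin N x by (metis card_mono finite_insert finite_subset insertCI not_less subsetI)
  have "connected_graph (V - ?N) {e \<in> E. e \<inter> ?N = {}}"
    using k_connectedD[OF conn N] few by simp
  then obtain a b where "a \<in> {x}" "b \<notin> {x}" "{a, b} \<in> {e \<in> E. e \<inter> ?N = {}}"
    by (rule crossing_edge[of _ _ x "{x}" y]) (use x y loop in auto)
  then show False by auto
qed

text \<open>
  Otherwise the ends in \<open>X\<close> of the edges of the cut are fewer than \<open>k\<close> vertices. They do not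
  exhaust \<open>X\<close>, and deleting them separates the rest of \<open>X\<close> from the other side.
\<close>

lemma edge_cut_large:
  assumes graph: "simple_graph V E" and conn: "k_connected k V E"
    and X: "X \<subset> V" "k \<le> card X"
  shows "k \<le> card {e \<in> E. e \<inter> X \<noteq> {} \<and> \<not> e \<subseteq> X}" (is "_ \<le> card ?C")
proof (rule ccontr)
  assume few: "\<not> ?thesis"
  let ?S = "{x \<in> X. \<exists>e\<in>?C. x \<in> e}"
  have fin: "finite V" "finite E"
    using graph unfolding simple_graph_def by (blast, meson PowI finite_Pow_iff finite_subset subsetI)
  have "?S \<subseteq> (\<lambda>e. SOME x. x \<in> e \<inter> X) ` ?C"
  proof
    fix x assume "x \<in> ?S"
    then obtain e where e: "e \<in> ?C" "x \<in> e" "x \<in> X" by blast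
    then obtain y where "e = {x, y}" using simple_graph_edge[OF graph] by blast
    moreover then have "y \<notin> X" using e by blast
    ultimately have "e \<inter> X = {x}" using e by blast
    then have "x = (SOME x. x \<in> e \<inter> X)" by simp
    then show "x \<in> (\<lambda>e. SOME x. x \<in> e \<inter> X) ` ?C" using e(1) by (rule image_eqI)
  qed
  moreover have "finite ?C" using fin by simp
  ultimately have small: "card ?S < k" using few surj_card_le by fastforce
  have "finite X" using X(1) fin(1) finite_subset by blast
  have "\<not> X \<subseteq> ?S"
  proof
    assume "X \<subseteq> ?S"
    then have "card X \<le> card ?S" using \<open>finite X\<close> by (intro card_mono) auto
    then show False using small X(2) by simp
  qed
  then obtain x where x: "x \<in> X" "x \<notin> ?S" by blast
  obtain y where y: "y \<in> V" "y \<notin> X" using X(1) by blast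
  have "?S \<subseteq> V" using X(1) by blast
  then have rest: "connected_graph (V - ?S) {e \<in> E. e \<inter> ?S = {}}"
    using k_connectedD[OF conn] small by blast
  have xy: "x \<in> V - ?S" "y \<in> V - ?S" using x y X(1) by blast+
  obtain a b where ab: "a \<in> X" "b \<notin> X" "{a, b} \<in> {e \<in> E. e \<inter> ?S = {}}"
    using crossing_edge[OF rest xy(1) x(1) xy(2) y(2)] .
  then have "{a, b} \<in> ?C" by blast
  then have "a \<in> ?S" using ab(1) by blast
  then show False using ab(3) by blast
qed

text \<open>
  A vertex of \<open>X\<close> has at least \<open>k\<close> neighbours, too many to fit into \<open>X\<close>, so each vertex of \<open>X\<close>
  has an edge out of \<open>X\<close>. Fix \<open>x\<close> in \<open>X\<close> and map each of its neighbours \<open>y\<close> to an edge of the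
  cut: to the edge from \<open>x\<close> if \<open>y\<close> is outside of \<open>X\<close>, and to an edge out of \<open>y\<close> if \<open>y\<close> is
  inside. These edges are different.
\<close>

lemma edge_cut_small:
  assumes graph: "simple_graph V E" and conn: "k_connected k V E" and large: "k < card V"
    and X: "X \<subset> V" "X \<noteq> {}" "card X < k"
  shows "k \<le> card {e \<in> E. e \<inter> X \<noteq> {} \<and> \<not> e \<subseteq> X}" (is "_ \<le> card ?C")
proof -
  have fin: "finite V" "finite E"
    using graph unfolding simple_graph_def by (blast, meson PowI finite_Pow_iff finite_subset subsetI)
  have "finite X" using X(1) fin(1) finite_subset by blast
  obtain x where x: "x \<in> X" using X(2) by blast
  let ?N = "{y. {x, y} \<in> E}"
  have loop: "x \<notin> ?N" using graph by (auto simp: simple_graph_def)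
  have "\<exists>z. {y, z} \<in> E \<and> z \<notin> X" if "y \<in> X" for y
  proof (rule ccontr)
    assume "\<not> ?thesis"
    then have "{z. {y, z} \<in> E} \<subseteq> X" by blast
    then have "card {z. {y, z} \<in> E} \<le> card X" using \<open>finite X\<close> by (rule card_mono[rotated])
    moreover have "k \<le> card {z. {y, z} \<in> E}"
      using min_degree[OF graph conn large] that X(1) by blast
    ultimately show False using X(3) by simp
  qed
  then obtain out where out: "\<And>y. y \<in> X \<Longrightarrow> {y, out y} \<in> E \<and> out y \<notin> X" by metis
  define g where "g y = (if y \<in> X then {y, out y} else {x, y})" for y
  have "inj_on g ?N"
  proof (rule inj_onI)
    fix y z assume yz: "y \<in> ?N" "z \<in> ?N" "g y = g z"
    then have "y \<noteq> x" "z \<noteq> x" using loop by blast+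
    then show "y = z"
      using yz(3) x out[of y] out[of z] unfolding g_def
      by (auto simp: doubleton_eq_iff split: if_splits)
  qed
  moreover have "g ` ?N \<subseteq> ?C" using x out unfolding g_def by auto
  moreover have "finite ?C" using fin by simp
  ultimately have "card ?N \<le> card ?C" by (rule card_inj_on_le)
  moreover have "k \<le> card ?N" using min_degree[OF graph conn large] x X(1) by blast
  ultimately show ?thesis by simp
qed

text \<open>
  The subgraphs are returned as symmetric relations, which is the form that the level coloring
  needs.
\<close>

lemma two_spanning_subgraphs:
  assumes graph: "simple_graph V E" and conn: "k_connected 4 V E" and large: "4 < card V"
  obtains D1 D2 :: "('a \<times> 'a) set" where "sym D1" "sym D2"
    "\<And>x y. (x, y) \<in> D1 \<union> D2 \<Longrightarrow> {x, y} \<in> E" "D1 \<inter> D2 = {}"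
    "V \<times> V \<subseteq> D1\<^sup>*" "V \<times> V \<subseteq> D2\<^sup>*"
proof -
  have fin: "finite V" using graph by (simp add: simple_graph_def)
  have "\<exists>p. e = {fst p, snd p}" if "e \<in> E" for e
  proof -
    have "card e = 2" using that graph by (simp add: simple_graph_def)
    then obtain x y where "e = {x, y}" unfolding card_2_iff by blast
    then show ?thesis by (intro exI[of _ "(x, y)"]) simp
  qed
  \<comment> \<open>\<open>h\<close> chooses an orientation of each edge\<close>
  then obtain h where h: "\<And>e. e \<in> E \<Longrightarrow> e = {fst (h e), snd (h e)}" by metis
  define G where "G = h ` E"
  have arc: "{x, y} \<in> E" "h {x, y} = (x, y)" if "(x, y) \<in> G" for x y
    using that h unfolding G_def by (metis fst_conv imageE snd_conv)+
  have GV: "G \<subseteq> V \<times> V" using arc(1) graph by (fastforce simp: simple_graph_def)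
  have cut: "2 * card (UNIV :: bool set) \<le> card {(x, y) \<in> G. x \<in> X \<longleftrightarrow> y \<notin> X}" (is "_ \<le> card ?A")
    if X: "X \<subset> V" "X \<noteq> {}" for X
  proof -
    let ?C = "{e \<in> E. e \<inter> X \<noteq> {} \<and> \<not> e \<subseteq> X}"
    have "4 \<le> card ?C"
      using edge_cut_large[OF graph conn X(1)] edge_cut_small[OF graph conn large X] by linarith
    also have "card ?C \<le> card ?A"
    proof (rule surj_card_le)
      show "finite ?A" using GV fin by (rule_tac finite_subset[of _ "V \<times> V"]) auto
      show "?C \<subseteq> (\<lambda>(x, y). {x, y}) ` ?A"
      proof
        fix e assume e: "e \<in> ?C"
        obtain x y where xy: "h e = (x, y)" by (metis surj_pair)
        then have "e = {x, y}" using h[of e] e by simp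
        moreover have "(x, y) \<in> ?A" using e xy calculation by (force simp: G_def)
        ultimately show "e \<in> (\<lambda>(x, y). {x, y}) ` ?A" by blast
      qed
    qed
    finally show ?thesis by (simp add: UNIV_bool)
  qed
  obtain F :: "bool \<Rightarrow> ('a \<times> 'a) set" where F: "\<And>i. F i \<subseteq> G" "\<And>i j. i \<noteq> j \<Longrightarrow> F i \<inter> F j = {}"
    "\<And>i. V \<times> V \<subseteq> connectivity (F i)"
    using spanning_packing[OF fin GV cut] by metis
  define D where "D i = F i \<union> (F i)\<inverse>" for i
  have D: "{x, y} \<in> E \<and> h {x, y} \<in> F i" if "(x, y) \<in> D i" for x y i
    using that arc F(1)[of i] unfolding D_def by (force simp: insert_commute)
  have "D True \<inter> D False = {}"
    using D F(2)[of True False] by fastforce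
  moreover have "sym (D i)" for i by (auto simp: D_def sym_def)
  moreover have "V \<times> V \<subseteq> (D i)\<^sup>*" for i using F(3)[of i] by (simp add: D_def connectivity_def)
  ultimately show ?thesis using that[of "D True" "D False"] D by blast
qed

section \<open>Six colors for 4-connected graphs\<close>

text \<open>
  Three colors are spent on the levels of each subgraph. The path of \<open>u\<close> to the root in the first
  subgraph is followed until it meets the path of \<open>v\<close> in the second one, and then the latter is
  followed to \<open>v\<close>. Since the palettes are disjoint, no square crosses the seam.
\<close>

theorem nrc_edge_disjoint_spanning:
  assumes r: "r \<in> V" and D1: "sym D1" "V \<times> V \<subseteq> D1\<^sup>*" and D2: "sym D2" "V \<times> V \<subseteq> D2\<^sup>*"
    and edges: "\<And>x y. (x, y) \<in> D1 \<union> D2 \<Longrightarrow> {x, y} \<in> E" and disj: "D1 \<inter> D2 = {}"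
    and graph: "simple_graph V E"
  shows "nrc V E \<le> 6"
proof -
  define c where "c e = (if \<exists>(x, y)\<in>D1. e = {x, y} then thue (Min (level D1 r ` e))
    else 3 + thue (Min (level D2 r ` e)))" for e
  have c1: "c {x, y} = thue (level D1 r y)" if "(x, y) \<in> descent D1 r" for x y
  proof -
    have "(x, y) \<in> D1" "Min (level D1 r ` {x, y}) = level D1 r y"
      using that by (simp_all add: descent_def)
    then show ?thesis unfolding c_def by auto
  qed
  have c2: "c {x, y} = 3 + thue (level D2 r y)" if "(x, y) \<in> descent D2 r" for x y
  proof -
    have xy: "(x, y) \<in> D2" "Min (level D2 r ` {x, y}) = level D2 r y"
      using that by (simp_all add: descent_def)
    have "\<not> (\<exists>(x', y')\<in>D1. {x, y} = {x', y'})"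
      using xy(1) disj D2(1) by (auto simp: doubleton_eq_iff sym_def)
    then show ?thesis unfolding c_def xy(2) by auto
  qed
  have "\<exists>p. is_path V E u p v \<and> nonrepetitive (path_colors c p)" if uv: "u \<in> V" "v \<in> V" for u v
  proof -
    have path: "\<exists>p. is_path V E w p r \<and> successively (\<lambda>x y. (x, y) \<in> descent D r) p"
      if "w \<in> V" "V \<times> V \<subseteq> D\<^sup>*" "D \<subseteq> D1 \<union> D2" for D w
    proof -
      have "(w, r) \<in> D\<^sup>*" using that(1,2) r by blast
      then obtain p where p: "p \<noteq> []" "hd p = w" "last p = r" "distinct p"
        "successively (\<lambda>x y. (x, y) \<in> descent D r) p"
        by (rule descending_path)
      have E: "{x, y} \<in> E" if "(x, y) \<in> descent D r" for x y
        using that edges \<open>D \<subseteq> D1 \<union> D2\<close> by (auto simp: descent_def)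
      have step: "y \<in> V" if "(x, y) \<in> descent D r" "x \<in> V" for x y
        using E[OF that(1)] graph by (auto simp: simple_graph_def)
      have "\<forall>x\<in>set p. x \<in> V"
        by (rule successively_invariant[OF p(5,1) _ step]) (simp_all add: p(2) \<open>w \<in> V\<close>)
      moreover have "successively (\<lambda>x y. {x, y} \<in> E) p"
        using successively_mono[OF p(5)] E by simp
      ultimately show ?thesis using p by (intro exI[of _ p]) (auto simp: is_path_def)
    qed
    obtain p where p: "is_path V E u p r" "successively (\<lambda>x y. (x, y) \<in> descent D1 r) p"
      using path[OF uv(1) D1(2)] by auto
    obtain q where q: "is_path V E v q r" "successively (\<lambda>x y. (x, y) \<in> descent D2 r) q"
      using path[OF uv(2) D2(2)] by auto
    have "r \<in> set p" "r \<in> set q" using p(1) q(1) unfolding is_path_def by (metis last_in_set)+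
    then obtain p1 x p2 where px: "p = p1 @ x # p2" "x \<in> set q" "\<forall>y\<in>set p1. y \<notin> set q"
      using split_list_first_prop[of p "\<lambda>y. y \<in> set q"] by auto
    then obtain q1 q2 where qx: "q = q1 @ x # q2" by (metis split_list)
    let ?p = "p1 @ [x]" and ?q = "q1 @ [x]"
    have prefix: "successively R (a @ [x])" if "successively R (a @ x # b)" for R a b
      using that successively_append_iff[of R "a @ [x]" b] by simp
    have p': "is_path V E u ?p x" "successively (\<lambda>x y. (x, y) \<in> descent D1 r) ?p"
      using is_path_prefix[OF p(1)[unfolded px(1)]] prefix[OF p(2)[unfolded px(1)]] .
    have q': "is_path V E v ?q x" "successively (\<lambda>x y. (x, y) \<in> descent D2 r) ?q"
      using is_path_prefix[OF q(1)[unfolded qx]] prefix[OF q(2)[unfolded qx]] .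
    have meet: "set ?p \<inter> set ?q = {x}" using px qx by auto
    have A: "d < 3" if "d \<in> set (path_colors c ?p)" for d
      using path_colors_elem[OF that p'(2)] c1 thue_less_3 by metis
    have B: "3 \<le> d" if "d \<in> set (rev (path_colors c ?q))" for d
      using path_colors_elem[OF _ q'(2)] c2 that by (metis le_add1 set_rev)
    have "nonrepetitive (path_colors c ?p)"
      by (rule nonrepetitive_descending[OF p'(2), where h = id]) (simp add: c1)
    moreover have "nonrepetitive (rev (path_colors c ?q))"
      unfolding nonrepetitive_rev
      by (rule nonrepetitive_descending[OF q'(2), where h = "\<lambda>n. n - 3"]) (simp add: c2)
    ultimately have "nonrepetitive (path_colors c ?p @ rev (path_colors c ?q))"
      by (rule nonrepetitive_append) (meson A B last_in_set hd_in_set not_less)+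
    then show ?thesis using is_path_join[OF p'(1) q'(1) meet] by metis
  qed
  then have "nonrepetitively_connected V E c" unfolding nonrepetitively_connected_def by blast
  moreover have "c ` E \<subseteq> {..<6}"
  proof (rule image_subsetI)
    fix e
    show "c e \<in> {..<6}"
      using thue_less_3[of "Min (level D1 r ` e)"] thue_less_3[of "Min (level D2 r ` e)"]
      by (auto simp: c_def)
  qed
  ultimately show ?thesis by (rule nrc_le) simp_all
qed

text \<open>
  Complete graphs with up to four vertices count as \<open>4\<close>-connected although their edge cuts are
  smaller than four. They have so few edges that all of them can get different colors.
\<close>

lemma nrc_small:
  assumes graph: "simple_graph V E" and conn: "connected_graph V E" and small: "card V \<le> 4"
  shows "nrc V E \<le> 6"
proof -
  have fin: "finite V" and E: "E \<subseteq> {e. e \<subseteq> V \<and> card e = 2}"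
    using graph by (auto simp: simple_graph_def)
  have "card V \<in> {0, 1, 2, 3, 4}" using small by auto
  then have "card V choose 2 \<le> 6" by (auto simp: choose_two)
  moreover have "card E \<le> card {e. e \<subseteq> V \<and> card e = 2}"
    using fin E by (intro card_mono) auto
  ultimately have "card E \<le> 6" using n_subsets[OF fin, of 2] by simp
  moreover have "finite E" using fin E by (rule_tac finite_subset[of _ "Pow V"]) auto
  ultimately show ?thesis using nrc_le_card_edges[OF conn] by fastforce
qed

theorem theorem5:
  fixes V :: "'a set" and E :: "'a set set"
  assumes "simple_graph V E" and "connected_graph V E"
  shows "(k_connected 2 V E \<longrightarrow> nrc V E \<le> 15) \<and> (k_connected 4 V E \<longrightarrow> nrc V E \<le> 6)"
proof (intro conjI impI)
  assume conn: "k_connected 2 V E"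
  show "nrc V E \<le> 15"
  proof (cases "E = {}")
    case True
    then show ?thesis using nrc_le_card_edges[OF assms(2)] by simp
  next
    case False
    then obtain e where "e \<in> E" by blast
    moreover have "card e = 2" using \<open>e \<in> E\<close> assms(1) by (simp add: simple_graph_def)
    then obtain s t where "e = {s, t}" unfolding card_2_iff by blast
    ultimately show ?thesis using nrc_two_connected[OF assms(1) conn] by blast
  qed
next
  assume conn: "k_connected 4 V E"
  show "nrc V E \<le> 6"
  proof (cases "card V \<le> 4")
    case True
    then show ?thesis using nrc_small assms by blast
  next
    case False
    then obtain r where "r \<in> V" by fastforce
    moreover obtain D1 D2 :: "('a \<times> 'a) set" where "sym D1" "sym D2"
      "\<And>x y. (x, y) \<in> D1 \<union> D2 \<Longrightarrow> {x, y} \<in> E" "D1 \<inter> D2 = {}"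
      "V \<times> V \<subseteq> D1\<^sup>*" "V \<times> V \<subseteq> D2\<^sup>*"
      using two_spanning_subgraphs[OF assms(1) conn] False by (metis not_le)
    ultimately show ?thesis using nrc_edge_disjoint_spanning assms(1) by metis
  qed
qed

end
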